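(* Let $K$ be an algebraic number field with ring of integers $\mathcal{O}_K$ and let $\mathfrak{n}$ be a non-zero ideal of $\mathcal{O}_K$. Then for every positive integer $k$, $$\varphi_k(\mathfrak{n}) = \varphi(\mathfrak{n})^k \prod_{\mathfrak{p}\mid \mathfrak{n}}\left(1-\frac{1}{N(\mathfrak{p})-1}+\frac{1}{(N(\mathfrak{p})-1)^2}+\cdots+\frac{(-1)^{k-1}}{(N(\mathfrak{p})-1)^{k-1}}\right),$$ where the product runs over the prime ideals $\mathfrak{p}$ dividing $\mathfrak{n}$.
   Context: For a nonzero ideal $\mathfrak{a}$ of $\mathcal{O}_K$, $N(\mathfrak{a}) = |\mathcal{O}_K/\mathfrak{a}|$ is the absolute norm, and $\varphi(\mathfrak{a}) = |(\mathcal{O}_K/\mathfrak{a})^*| = N(\mathfrak{a})\prod_{\mathfrak{p}\mid\mathfrak{a}}(1-1/N(\mathfrak{p}))$. For a positive integer $k$, the $k$-dimensional generalized Euler function is $$\varphi_k(\mathfrak{n}) = \#\{(a_1,\ldots,a_k) : a_1,\ldots,a_k \in (\mathcal{O}_K/\mathfrak{n})^*,\ a_1+\cdots+a_k \in (\mathcal{O}_K/\mathfrak{n})^*\}.$$ *)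

theory Defs
  imports Complex_Main
    "HOL-Computational_Algebra.Polynomial"
    "HOL-Algebra.Algebraic_Closure_Type"
    "HOL-Algebra.Ideal_Product"
    "HOL-Algebra.QuotRing"
begin

text \<open>
  A number field is given as a subfield of an arbitrary ambient field of characteristic 0
  (possibly the whole type) that is finite-dimensional over the prime field.
\<close>

definition number_field :: "'a :: field_char_0 set \<Rightarrow> bool" where
  "number_field K \<longleftrightarrow>
     subfield K ring_of_type_algebra \<and>
     ring.finite_dimension ring_of_type_algebra \<rat> K"

definition ring_of_integers :: "'a :: field_char_0 set \<Rightarrow> 'a ring" where
  "ring_of_integers K = ring_of_type_algebra \<lparr>carrier := {x \<in> K. algebraic_int x}\<rparr>"

definition ideal_norm :: "('a, 'b) ring_scheme \<Rightarrow> 'a set \<Rightarrow> nat" where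
  "ideal_norm R I = card (carrier (R Quot I))"

definition ideal_totient :: "('a, 'b) ring_scheme \<Rightarrow> 'a set \<Rightarrow> nat" where
  "ideal_totient R I = card (Units (R Quot I))"

text \<open>The \<open>k\<close>-tuples are extensional functions, so that each tuple is counted once.\<close>

definition gen_ideal_totient :: "('a, 'b) ring_scheme \<Rightarrow> nat \<Rightarrow> 'a set \<Rightarrow> nat" where
  "gen_ideal_totient R k I =
     card {a \<in> {1..k} \<rightarrow>\<^sub>E Units (R Quot I).
             (\<Oplus>\<^bsub>R Quot I\<^esub>i\<in>{1..k}. a i) \<in> Units (R Quot I)}"

definition ideal_dvd :: "('a, 'b) ring_scheme \<Rightarrow> 'a set \<Rightarrow> 'a set \<Rightarrow> bool" where
  "ideal_dvd R I J \<longleftrightarrow> (\<exists>L. ideal L R \<and> J = ideal_prod R I L)"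

definition prime_ideal_divisors :: "('a, 'b) ring_scheme \<Rightarrow> 'a set \<Rightarrow> 'a set set" where
  "prime_ideal_divisors R I = {P. primeideal P R \<and> ideal_dvd R P I}"

end

theory Submission
  imports Defs
begin

text \<open>
  An element of \<open>\<O>/\<nn>\<close> is a unit iff its image in each residue field \<open>\<O>/\<pp>\<close>, \<open>\<pp> \<supseteq> \<nn>\<close>, is
  nonzero, and by the Chinese remainder theorem the map to the product of these fields is onto,
  with fibres of constant size. So the count splits into counts over finite fields \<open>F\<close>. There the
  \<open>(k+1)\<close>-tuples of nonzero elements with sum zero correspond to the \<open>k\<close>-tuples with nonzero sum,
  which gives \<open>s\<^sub>k\<^sub>+\<^sub>1 = (|F| - 1)\<^sup>k\<^sup>+\<^sup>1 - s\<^sub>k\<close>.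

  Finiteness of \<open>\<O>/a\<O>\<close> needs no integral basis: elements of \<open>\<O>\<close> that are independent modulo
  \<open>p\<O>\<close> are independent over the rationals. That \<open>\<nn> \<subseteq> \<pp>\<close> implies \<open>\<pp> | \<nn>\<close> is the invertibility of
  \<open>\<pp>\<close>: some \<open>g = b/a\<close> outside \<open>\<O>\<close> satisfies \<open>g\<pp> \<subseteq> \<O>\<close>, and \<open>g\<pp> \<subseteq> \<pp>\<close> is impossible because, the
  quotients being finite, two powers of \<open>g\<close> would differ by an element of \<open>\<O>\<close>, so that \<open>g\<close> is
  integral.
\<close>

section \<open>Counting tuples through residue fields\<close>

lemma card_eq_fibres:
  assumes "finite T" "f ` S \<subseteq> T" "\<And>t. t \<in> T \<Longrightarrow> card {x \<in> S. f x = t} = c" "finite S"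
  shows "card S = c * card T"
proof -
  have "card S = (\<Sum>x\<in>S. 1)" by simp
  also have "\<dots> = (\<Sum>t\<in>T. \<Sum>x\<in>{x \<in> S. f x = t}. 1)"
    using assms by (intro sum.group [symmetric]) auto
  also have "\<dots> = (\<Sum>t\<in>T. c)" using assms(3) by simp
  finally show ?thesis by simp
qed

section \<open>Tuples of nonzero elements with nonzero sum in a finite abelian group\<close>

text \<open>In a field the nonzero elements are the units, so for a residue field this is the set
  that \<open>gen_ideal_totient\<close> counts.\<close>

definition (in abelian_group) nonzero_sum_tuples :: "nat \<Rightarrow> (nat \<Rightarrow> 'a) set" where
  "nonzero_sum_tuples k =
     {t \<in> {1..k} \<rightarrow>\<^sub>E carrier G - {\<zero>}. (\<Oplus>i\<in>{1..k}. t i) \<noteq> \<zero>}"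

context abelian_group
begin

text \<open>A tuple of length k+1 with sum zero is determined by its first k entries, the last being
  minus their sum, and that entry is nonzero exactly if the sum is. So the second summand counts the
  tuples excluded from the first.\<close>

lemma card_nonzero_sum_tuples_Suc:
  assumes fin: "finite (carrier G)"
  shows "card (nonzero_sum_tuples (Suc k)) + card (nonzero_sum_tuples k) =
           (card (carrier G) - 1) ^ Suc k"
proof -
  define U where "U = {1..Suc k} \<rightarrow>\<^sub>E carrier G - {\<zero>}"
  define Z where "Z = {t \<in> U. (\<Oplus>i\<in>{1..Suc k}. t i) = \<zero>}"
  have finU: "finite U" unfolding U_def using fin by (intro finite_PiE) auto
  have split: "{1..Suc k} = insert (Suc k) {1..k}" by auto
  have sumS: "(\<Oplus>i\<in>{1..Suc k}. t i) = t (Suc k) \<oplus> (\<Oplus>i\<in>{1..k}. t i)"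
    if "t \<in> {1..Suc k} \<rightarrow> carrier G" for t
    unfolding split using that by (subst finsum_insert) auto
  have bij: "bij_betw (\<lambda>t. t(Suc k := \<ominus> (\<Oplus>i\<in>{1..k}. t i))) (nonzero_sum_tuples k) Z"
  proof (rule bij_betw_byWitness [where f' = "\<lambda>t. restrict t {1..k}"])
    show "\<forall>t\<in>nonzero_sum_tuples k.
        restrict (t(Suc k := \<ominus> (\<Oplus>i\<in>{1..k}. t i))) {1..k} = t"
      by (auto simp: nonzero_sum_tuples_def PiE_def extensional_def restrict_def fun_eq_iff)
    show "\<forall>t\<in>Z. (restrict t {1..k})(Suc k := \<ominus> (\<Oplus>i\<in>{1..k}. restrict t {1..k} i)) = t"
    proof
      fix t assume t: "t \<in> Z"
      then have tc: "t \<in> {1..Suc k} \<rightarrow> carrier G"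
        by (auto simp: Z_def U_def)
      have c: "(\<Oplus>i\<in>{1..k}. t i) \<in> carrier G" using tc by (intro finsum_closed) auto
      have r: "(\<Oplus>i\<in>{1..k}. restrict t {1..k} i) = (\<Oplus>i\<in>{1..k}. t i)"
        using tc by (intro finsum_cong') auto
      have "t (Suc k) \<oplus> (\<Oplus>i\<in>{1..k}. t i) = \<zero>"
        using t sumS [OF tc] by (simp add: Z_def)
      moreover have "t (Suc k) \<in> carrier G" using tc by auto
      ultimately have "\<ominus> (\<Oplus>i\<in>{1..k}. t i) = t (Suc k)"
        using c by (metis minus_equality)
      with t r show "(restrict t {1..k})(Suc k := \<ominus> (\<Oplus>i\<in>{1..k}. restrict t {1..k} i)) = t"
        by (auto simp: Z_def U_def PiE_def extensional_def fun_eq_iff)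
    qed
    show "(\<lambda>t. t(Suc k := \<ominus> (\<Oplus>i\<in>{1..k}. t i))) ` nonzero_sum_tuples k \<subseteq> Z"
    proof clarify
      fix t assume t: "t \<in> nonzero_sum_tuples k"
      define s where "s = (\<Oplus>i\<in>{1..k}. t i)"
      have s: "s \<in> carrier G" "s \<noteq> \<zero>"
        using t unfolding s_def nonzero_sum_tuples_def by (auto intro!: finsum_closed)
      have ms: "\<ominus> s \<in> carrier G - {\<zero>}"
        using s add.inv_eq_1_iff [of s] by (simp add: a_inv_def)
      have u: "t(Suc k := \<ominus> s) \<in> U"
        using t ms by (auto simp: U_def nonzero_sum_tuples_def PiE_def extensional_def Pi_def le_Suc_eq)
      have c: "t(Suc k := \<ominus> s) \<in> {1..Suc k} \<rightarrow> carrier G"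
        using u by (auto simp: U_def)
      have "(\<Oplus>i\<in>{1..k}. (t(Suc k := \<ominus> s)) i) = s"
        unfolding s_def using t by (intro finsum_cong') (auto simp: nonzero_sum_tuples_def)
      then have "(\<Oplus>i\<in>{1..Suc k}. (t(Suc k := \<ominus> s)) i) = \<zero>"
        using sumS [OF c] s by (simp add: l_neg)
      with u show "t(Suc k := \<ominus> (\<Oplus>i\<in>{1..k}. t i)) \<in> Z"
        unfolding Z_def s_def by blast
    qed
    show "(\<lambda>t. restrict t {1..k}) ` Z \<subseteq> nonzero_sum_tuples k"
    proof clarify
      fix t assume t: "t \<in> Z"
      then have tc: "t \<in> {1..Suc k} \<rightarrow> carrier G" and tn: "t (Suc k) \<noteq> \<zero>"
        by (auto simp: Z_def U_def)
      have r: "(\<Oplus>i\<in>{1..k}. restrict t {1..k} i) = (\<Oplus>i\<in>{1..k}. t i)"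
        using tc by (intro finsum_cong') auto
      have "t (Suc k) \<in> carrier G" using tc by auto
      then have "(\<Oplus>i\<in>{1..k}. t i) \<noteq> \<zero>"
        using t sumS [OF tc] tn r_zero by (fastforce simp: Z_def)
      with r have "(\<Oplus>i\<in>{1..k}. restrict t {1..k} i) \<noteq> \<zero>" by simp
      moreover have "restrict t {1..k} \<in> {1..k} \<rightarrow>\<^sub>E carrier G - {\<zero>}"
        using t by (auto simp: Z_def U_def)
      ultimately show "restrict t {1..k} \<in> nonzero_sum_tuples k"
        unfolding nonzero_sum_tuples_def by blast
    qed
  qed
  have "nonzero_sum_tuples (Suc k) = U - Z"
    by (auto simp: nonzero_sum_tuples_def Z_def U_def)
  then have "card (nonzero_sum_tuples (Suc k)) + card Z = card U"
    using finU by (metis (no_types, lifting) Z_def card_Diff_subset card_mono finite_subset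
        le_add_diff_inverse2 mem_Collect_eq subsetI)
  moreover have "card Z = card (nonzero_sum_tuples k)"
    using bij by (simp add: bij_betw_same_card)
  moreover have "card U = (card (carrier G) - 1) ^ Suc k"
    unfolding U_def by (simp add: card_PiE card_Diff_singleton)
  ultimately show ?thesis by simp
qed

text \<open>Iterating the recursion gives q^k - q^(k-1) + ... up to a last term q or -q, where q is
  the cardinality minus 1; the formula takes out q^k, which is possible because q is
  nonzero.\<close>

lemma card_nonzero_sum_tuples:
  assumes "finite (carrier G)" "card (carrier G) \<noteq> 1" "k > 0"
  shows "real (card (nonzero_sum_tuples k)) =
           (real (card (carrier G)) - 1) ^ k *
           (\<Sum>j=0..k-1. (-1) ^ j / (real (card (carrier G)) - 1) ^ j)"
proof -
  define q where "q = real (card (carrier G)) - 1"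
  have "card (carrier G) > 0" using assms(1) by (auto simp: card_gt_0_iff)
  then have q: "q \<noteq> 0" "real (card (carrier G) - 1) = q" using assms(2) by (auto simp: q_def)
  \<comment> \<open>The range \<open>j<k\<close> lets the induction start at 0, where both sides
    vanish; \<open>{0..k-1}\<close> would still contain 0 there.\<close>
  have "real (card (nonzero_sum_tuples k)) = q ^ k * (\<Sum>j<k. (-1) ^ j / q ^ j)"
  proof (induction k)
    case 0
    show ?case by (simp add: nonzero_sum_tuples_def)
  next
    case (Suc k)
    \<comment> \<open>Split off j = 0 and take a factor -1/q out of the other terms.\<close>
    have "(\<Sum>j<Suc k. (-1) ^ j / q ^ j) = 1 - (\<Sum>j<k. (-1) ^ j / q ^ j) / q"
      by (subst sum.lessThan_Suc_shift) (simp add: sum_divide_distrib sum_negf mult.commute)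
    from arg_cong [OF this, of "\<lambda>x. q ^ Suc k * x"] have "q ^ Suc k * (\<Sum>j<Suc k. (-1) ^ j / q ^ j) =
        q ^ Suc k - q ^ k * (\<Sum>j<k. (-1) ^ j / q ^ j)"
      using q by (simp add: right_diff_distrib del: sum.lessThan_Suc)
    moreover have "real (card (nonzero_sum_tuples (Suc k))) =
        q ^ Suc k - real (card (nonzero_sum_tuples k))"
      using arg_cong [OF card_nonzero_sum_tuples_Suc [OF assms(1), of k], of real] q
      by (simp only: of_nat_add of_nat_power)
    ultimately show ?case using Suc by simp
  qed
  moreover have "{0..k-1} = {..<k}" using assms(3) by auto
  ultimately show ?thesis by (simp add: q_def)
qed

end

section \<open>Counting in a finite ring through its residue fields\<close>

text \<open>For \<open>A\<close> = O/n and \<open>B p\<close> = O/p, \<open>surj\<close> is the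
  Chinese remainder theorem and \<open>unit\<close> the criterion for units. The joint map may have
  a nonzero kernel, as it does when the square of a prime divides n.\<close>

locale residue_fields =
  fixes A :: "'a ring" and B :: "'i \<Rightarrow> 'b ring" and h :: "'i \<Rightarrow> 'a \<Rightarrow> 'b" and S :: "'i set"
  assumes A: "cring A" and finA: "finite (carrier A)" and finS: "finite S"
    and B: "p \<in> S \<Longrightarrow> field (B p)"
    and h: "p \<in> S \<Longrightarrow> h p \<in> ring_hom A (B p)"
    and surj: "(\<And>p. p \<in> S \<Longrightarrow> b p \<in> carrier (B p)) \<Longrightarrow> \<exists>a\<in>carrier A. \<forall>p\<in>S. h p a = b p"
    and unit: "a \<in> carrier A \<Longrightarrow> a \<in> Units A \<longleftrightarrow> (\<forall>p\<in>S. h p a \<noteq> \<zero>\<^bsub>B p\<^esub>)"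
begin

definition fibre where "fibre b = {a \<in> carrier A. \<forall>p\<in>S. h p a = b p}"

lemma hom_ring: "p \<in> S \<Longrightarrow> ring_hom_cring A (B p) (h p)"
  using A B h by (intro ring_hom_cringI ring_hom_ringI2)
     (auto simp: field_def domain_def cring_def)

lemma finB: assumes "p \<in> S" shows "finite (carrier (B p))"
proof (rule finite_surj [OF finA, of _ "h p"], rule subsetI)
  fix x assume x: "x \<in> carrier (B p)"
  \<comment> \<open>Zeros at the other indices complete \<open>x\<close> to a family to which
    \<open>surj\<close> applies.\<close>
  define b where "b = (\<lambda>q. if q = p then x else \<zero>\<^bsub>B q\<^esub>)"
  have "b q \<in> carrier (B q)" if "q \<in> S" for q
    using x B [OF that] by (auto simp: b_def intro: ring.ring_simprules fieldE domain.axioms cring.axioms)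
  from surj [of b, OF this] obtain a where "a \<in> carrier A" "h p a = b p" using assms by auto
  then show "x \<in> h p ` carrier A" by (auto simp: b_def)
qed

text \<open>Translation by a preimage of \<open>b\<close> carries the kernel of the joint map onto
  the fibre over \<open>b\<close>.\<close>

lemma card_fibre:
  assumes "\<And>p. p \<in> S \<Longrightarrow> b p \<in> carrier (B p)"
  shows "card (fibre b) = card (fibre (\<lambda>p. \<zero>\<^bsub>B p\<^esub>))"
proof -
  interpret A: cring A by (rule A)
  obtain a where a: "a \<in> carrier A" "\<forall>p\<in>S. h p a = b p" using surj [OF assms] by blast
  have "bij_betw (\<lambda>x. x \<oplus>\<^bsub>A\<^esub> a) (fibre (\<lambda>p. \<zero>\<^bsub>B p\<^esub>)) (fibre b)"
  proof (rule bij_betw_byWitness [where f' = "\<lambda>x. x \<ominus>\<^bsub>A\<^esub> a"])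
    show "(\<lambda>x. x \<oplus>\<^bsub>A\<^esub> a) ` fibre (\<lambda>p. \<zero>\<^bsub>B p\<^esub>) \<subseteq> fibre b"
    proof clarify
      fix x assume x: "x \<in> fibre (\<lambda>p. \<zero>\<^bsub>B p\<^esub>)"
      have "h p (x \<oplus>\<^bsub>A\<^esub> a) = b p" if p: "p \<in> S" for p
      proof -
        interpret ring_hom_cring A "B p" "h p" by (rule hom_ring [OF p])
        show ?thesis using x a p assms [OF p] by (simp add: fibre_def)
      qed
      then show "x \<oplus>\<^bsub>A\<^esub> a \<in> fibre b" using x a by (auto simp: fibre_def)
    qed
    show "(\<lambda>x. x \<ominus>\<^bsub>A\<^esub> a) ` fibre b \<subseteq> fibre (\<lambda>p. \<zero>\<^bsub>B p\<^esub>)"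
    proof clarify
      fix x assume x: "x \<in> fibre b"
      have "h p (x \<ominus>\<^bsub>A\<^esub> a) = \<zero>\<^bsub>B p\<^esub>" if p: "p \<in> S" for p
      proof -
        interpret ring_hom_cring A "B p" "h p" by (rule hom_ring [OF p])
        show ?thesis using x a p assms [OF p] by (simp add: fibre_def A.minus_eq S.r_neg)
      qed
      then show "x \<ominus>\<^bsub>A\<^esub> a \<in> fibre (\<lambda>p. \<zero>\<^bsub>B p\<^esub>)" using x a by (auto simp: fibre_def)
    qed
  qed (use a in \<open>auto simp: fibre_def A.minus_eq A.a_assoc A.r_neg A.l_neg\<close>)
  then show ?thesis by (metis bij_betw_same_card)
qed

text \<open>Reducing the entries at every p turns a tuple into a family of k-tuples over the residue
  fields. Prescribing this family confines each of the k entries to one fibre, and all fibres have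
  the size of the kernel.\<close>

lemma card_tuples:
  fixes k :: nat
  assumes T: "\<And>p. p \<in> S \<Longrightarrow> T p \<subseteq> {1..k} \<rightarrow>\<^sub>E carrier (B p)"
  shows "card {a \<in> {1..k} \<rightarrow>\<^sub>E carrier A. \<forall>p\<in>S. (\<lambda>i\<in>{1..k}. h p (a i)) \<in> T p} =
           card (fibre (\<lambda>p. \<zero>\<^bsub>B p\<^esub>)) ^ k * (\<Prod>p\<in>S. card (T p))"
proof -
  define M where "M = {a \<in> {1..k} \<rightarrow>\<^sub>E carrier A. \<forall>p\<in>S. (\<lambda>i\<in>{1..k}. h p (a i)) \<in> T p}"
  define \<Phi> where "\<Phi> a = (\<lambda>p\<in>S. \<lambda>i\<in>{1..k}. h p (a i))" for a
  have finT: "finite (T p)" if "p \<in> S" for p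
    by (rule finite_subset [OF T [OF that]]) (use finB [OF that] in \<open>auto intro: finite_PiE\<close>)
  have "card M = card (fibre (\<lambda>p. \<zero>\<^bsub>B p\<^esub>)) ^ k * card (PiE S T)"
  proof (rule card_eq_fibres [where f = \<Phi>])
    show "finite (PiE S T)" using finS finT by (intro finite_PiE)
    show "finite M" unfolding M_def
      by (rule finite_subset [of _ "{1..k} \<rightarrow>\<^sub>E carrier A"]) (use finA in \<open>auto intro: finite_PiE\<close>)
    show "\<Phi> ` M \<subseteq> PiE S T" by (auto simp: M_def \<Phi>_def)
    fix t assume t: "t \<in> PiE S T"
    have tT: "t p \<in> {1..k} \<rightarrow>\<^sub>E carrier (B p)" "t p \<in> T p" if "p \<in> S" for p
      using T [OF that] t that by auto
    have eq: "\<Phi> a = t \<longleftrightarrow> (\<forall>p\<in>S. (\<lambda>i\<in>{1..k}. h p (a i)) = t p)" for a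
      using t by (auto simp: \<Phi>_def fun_eq_iff PiE_def extensional_def)
    have eq2: "(\<lambda>i\<in>{1..k}. h p (a i)) = t p \<longleftrightarrow> (\<forall>i\<in>{1..k}. h p (a i) = t p i)" if "p \<in> S" for p a
      using tT(1) [OF that] by (auto simp: fun_eq_iff PiE_def extensional_def)
    \<comment> \<open>Once the image is \<open>t\<close>, the conditions \<open>T p\<close> hold
      automatically and the k entries can be chosen independently.\<close>
    have "{a \<in> M. \<Phi> a = t} = {a \<in> {1..k} \<rightarrow>\<^sub>E carrier A. \<Phi> a = t}"
      using tT(2) by (auto simp: M_def eq)
    also have "\<dots> = PiE {1..k} (\<lambda>i. fibre (\<lambda>p. t p i))"
      using eq2 by (auto simp: eq fibre_def PiE_def Pi_def)
    finally have "card {a \<in> M. \<Phi> a = t} = (\<Prod>i\<in>{1..k}. card (fibre (\<lambda>p. t p i)))"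
      by (simp add: card_PiE)
    also have "\<dots> = (\<Prod>i\<in>{1..k}. card (fibre (\<lambda>p. \<zero>\<^bsub>B p\<^esub>)))"
      using PiE_mem [OF tT(1)] by (intro prod.cong card_fibre) auto
    finally show "card {a \<in> M. \<Phi> a = t} = card (fibre (\<lambda>p. \<zero>\<^bsub>B p\<^esub>)) ^ k" by simp
  qed
  then show ?thesis using finS by (simp add: M_def card_PiE)
qed

text \<open>\<open>card_tuples\<close> is used twice: for tuples of nonzero elements, which describe
  all unit tuples, and for those with nonzero sum as well. Both counts contain the same power of the
  kernel size, so their ratio is the product of the local ratios.\<close>

lemma card_unit_tuples:
  fixes k :: nat
  assumes k: "k > 0"
  shows "real (card {a \<in> {1..k} \<rightarrow>\<^sub>E Units A. (\<Oplus>\<^bsub>A\<^esub>i\<in>{1..k}. a i) \<in> Units A}) =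
           real (card (Units A)) ^ k *
           (\<Prod>p\<in>S. \<Sum>j=0..k-1. (-1) ^ j / (real (card (carrier (B p))) - 1) ^ j)"
proof -
  interpret A: cring A by (rule A)
  define c where "c = card (fibre (\<lambda>p. \<zero>\<^bsub>B p\<^esub>))"
  define T where "T p = abelian_group.nonzero_sum_tuples (B p) k" for p
  define U where "U p = {1..k} \<rightarrow>\<^sub>E carrier (B p) - {\<zero>\<^bsub>B p\<^esub>}" for p
  have Bab: "abelian_group (B p)" if "p \<in> S" for p
    using B [OF that] by (simp add: field_def domain_def cring_def ring_def)
  have T: "T p = {t \<in> U p. (\<Oplus>\<^bsub>B p\<^esub>i\<in>{1..k}. t i) \<noteq> \<zero>\<^bsub>B p\<^esub>}" if "p \<in> S" for p
    unfolding T_def abelian_group.nonzero_sum_tuples_def [OF Bab [OF that]] U_def ..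
  have units: "a \<in> {1..k} \<rightarrow>\<^sub>E Units A \<longleftrightarrow>
      a \<in> {1..k} \<rightarrow>\<^sub>E carrier A \<and> (\<forall>p\<in>S. (\<lambda>i\<in>{1..k}. h p (a i)) \<in> U p)" for a
  proof -
    have "h p x \<in> carrier (B p)" if "p \<in> S" "x \<in> carrier A" for p x
      using h [OF that(1)] that(2) by (auto simp: ring_hom_def)
    moreover have "x \<in> Units A \<longleftrightarrow> x \<in> carrier A \<and> (\<forall>p\<in>S. h p x \<noteq> \<zero>\<^bsub>B p\<^esub>)" for x
      using unit A.Units_closed by blast
    ultimately show ?thesis
      by (auto simp: U_def PiE_iff Ball_def)
  qed
  have "card ({1..k} \<rightarrow>\<^sub>E Units A) =
      card {a \<in> {1..k} \<rightarrow>\<^sub>E carrier A. \<forall>p\<in>S. (\<lambda>i\<in>{1..k}. h p (a i)) \<in> U p}"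
    by (intro arg_cong [where f = card]) (use units in auto)
  also have "\<dots> = c ^ k * (\<Prod>p\<in>S. card (U p))"
    unfolding c_def by (rule card_tuples) (auto simp: U_def)
  finally have 1: "card (Units A) ^ k = c ^ k * (\<Prod>p\<in>S. card (U p))"
    by (simp add: card_PiE)
  have sum_unit: "(\<Oplus>\<^bsub>A\<^esub>i\<in>{1..k}. a i) \<in> Units A \<longleftrightarrow>
      (\<forall>p\<in>S. (\<Oplus>\<^bsub>B p\<^esub>i\<in>{1..k}. (\<lambda>i\<in>{1..k}. h p (a i)) i) \<noteq> \<zero>\<^bsub>B p\<^esub>)"
    if a: "a \<in> {1..k} \<rightarrow>\<^sub>E carrier A" for a
  proof -
    have "h p (\<Oplus>\<^bsub>A\<^esub>i\<in>{1..k}. a i) = (\<Oplus>\<^bsub>B p\<^esub>i\<in>{1..k}. (\<lambda>i\<in>{1..k}. h p (a i)) i)" if p: "p \<in> S" for p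
    proof -
      interpret ring_hom_cring A "B p" "h p" by (rule hom_ring [OF p])
      have "h p (\<Oplus>\<^bsub>A\<^esub>i\<in>{1..k}. a i) = (\<Oplus>\<^bsub>B p\<^esub>i\<in>{1..k}. h p (a i))"
        using a by (subst hom_finsum) (auto simp: o_def)
      also have "\<dots> = (\<Oplus>\<^bsub>B p\<^esub>i\<in>{1..k}. (\<lambda>i\<in>{1..k}. h p (a i)) i)"
        using PiE_mem [OF a] by (intro S.finsum_cong') auto
      finally show ?thesis .
    qed
    moreover have "(\<Oplus>\<^bsub>A\<^esub>i\<in>{1..k}. a i) \<in> carrier A"
      using a by (intro A.finsum_closed) auto
    ultimately show ?thesis using unit by auto
  qed
  have "{a \<in> {1..k} \<rightarrow>\<^sub>E Units A. (\<Oplus>\<^bsub>A\<^esub>i\<in>{1..k}. a i) \<in> Units A} =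
      {a \<in> {1..k} \<rightarrow>\<^sub>E carrier A. \<forall>p\<in>S. (\<lambda>i\<in>{1..k}. h p (a i)) \<in> T p}"
  proof (rule Collect_cong)
    fix a
    have T_iff: "(\<forall>p\<in>S. r p \<in> T p) \<longleftrightarrow>
        (\<forall>p\<in>S. r p \<in> U p) \<and> (\<forall>p\<in>S. (\<Oplus>\<^bsub>B p\<^esub>i\<in>{1..k}. r p i) \<noteq> \<zero>\<^bsub>B p\<^esub>)" for r
      using T by auto
    show "a \<in> {1..k} \<rightarrow>\<^sub>E Units A \<and> (\<Oplus>\<^bsub>A\<^esub>i\<in>{1..k}. a i) \<in> Units A \<longleftrightarrow>
        a \<in> {1..k} \<rightarrow>\<^sub>E carrier A \<and> (\<forall>p\<in>S. (\<lambda>i\<in>{1..k}. h p (a i)) \<in> T p)"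
      unfolding units T_iff using sum_unit [of a] by blast
  qed
  then have 2: "card {a \<in> {1..k} \<rightarrow>\<^sub>E Units A. (\<Oplus>\<^bsub>A\<^esub>i\<in>{1..k}. a i) \<in> Units A} =
      c ^ k * (\<Prod>p\<in>S. card (T p))"
    unfolding c_def using T by (subst card_tuples [symmetric]) (auto simp: U_def)
  have "real (card (T p)) = real (card (U p)) *
      (\<Sum>j=0..k-1. (-1) ^ j / (real (card (carrier (B p))) - 1) ^ j)" if p: "p \<in> S" for p
  proof -
    interpret field "B p" by (rule B [OF p])
    \<comment> \<open>Zero and one differ, so the denominators |F| - 1 do not vanish.\<close>
    have "card {\<zero>\<^bsub>B p\<^esub>, \<one>\<^bsub>B p\<^esub>} \<le> card (carrier (B p))"
      by (rule card_mono [OF finB [OF p]]) auto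
    then have "card (carrier (B p)) \<ge> 2" by simp
    then show ?thesis unfolding T_def
      using card_nonzero_sum_tuples [OF finB [OF p] _ k]
      by (simp add: U_def card_PiE card_Diff_singleton)
  qed
  then have "(\<Prod>p\<in>S. real (card (T p))) = (\<Prod>p\<in>S. real (card (U p))) *
      (\<Prod>p\<in>S. \<Sum>j=0..k-1. (-1) ^ j / (real (card (carrier (B p))) - 1) ^ j)"
    by (simp add: prod.distrib)
  with 2 arg_cong [OF 1, of real] show ?thesis by simp
qed

end

lemma ring_of_type_algebra_simps [simp]:
  "x \<otimes>\<^bsub>ring_of_type_algebra\<^esub> y = x * y" "x \<oplus>\<^bsub>ring_of_type_algebra\<^esub> y = x + y"
  "\<one>\<^bsub>ring_of_type_algebra\<^esub> = 1" "\<zero>\<^bsub>ring_of_type_algebra\<^esub> = 0"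
  by (simp_all add: ring_of_type_algebra_def)

section \<open>Subrings of a field and their quotients\<close>

text \<open>Placing the ring inside a field type makes its operations the ordinary ones and gives
  access to fractions b/a that lie outside it.\<close>

locale field_subring =
  fixes R :: "'a :: Fields.field set"
  assumes zero_mem [simp]: "0 \<in> R" and one_mem [simp]: "1 \<in> R"
    and add_mem [simp]: "x \<in> R \<Longrightarrow> y \<in> R \<Longrightarrow> x + y \<in> R"
    and mult_mem [simp]: "x \<in> R \<Longrightarrow> y \<in> R \<Longrightarrow> x * y \<in> R"
    and minus_mem [simp]: "x \<in> R \<Longrightarrow> - x \<in> R"
begin

abbreviation "RR \<equiv> ring_of_type_algebra\<lparr>carrier := R\<rparr>"

lemma diff_mem [simp]: "x \<in> R \<Longrightarrow> y \<in> R \<Longrightarrow> x - y \<in> R"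
  using add_mem [of x "- y"] by simp

lemma power_mem [simp]: "x \<in> R \<Longrightarrow> x ^ n \<in> R"
  by (induction n) auto

lemma cring_RR: "cring RR"
proof (rule cringI)
  show "abelian_group RR"
  proof (rule abelian_groupI)
    fix x assume "x \<in> carrier RR"
    then show "\<exists>y\<in>carrier RR. y \<oplus>\<^bsub>RR\<^esub> x = \<zero>\<^bsub>RR\<^esub>"
      by (intro bexI [of _ "- x"]) auto
  qed (auto simp: algebra_simps)
  show "comm_monoid RR"
    by (rule comm_monoidI) (auto simp: algebra_simps)
qed (auto simp: algebra_simps)

sublocale RR: cring RR by (rule cring_RR)

lemma a_inv_RR [simp]: "x \<in> R \<Longrightarrow> \<ominus>\<^bsub>RR\<^esub> x = - x"
  using RR.minus_equality [of "- x" x] by simp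

lemma ideal_iff:
  "ideal I RR \<longleftrightarrow> I \<subseteq> R \<and> 0 \<in> I \<and> (\<forall>x\<in>I. \<forall>y\<in>I. x + y \<in> I) \<and> (\<forall>r\<in>R. \<forall>x\<in>I. r * x \<in> I)"
proof
  assume "ideal I RR"
  then interpret ideal I RR .
  show "I \<subseteq> R \<and> 0 \<in> I \<and> (\<forall>x\<in>I. \<forall>y\<in>I. x + y \<in> I) \<and> (\<forall>r\<in>R. \<forall>x\<in>I. r * x \<in> I)"
    using a_subset zero_closed a_closed I_l_closed by auto
next
  assume I: "I \<subseteq> R \<and> 0 \<in> I \<and> (\<forall>x\<in>I. \<forall>y\<in>I. x + y \<in> I) \<and> (\<forall>r\<in>R. \<forall>x\<in>I. r * x \<in> I)"
  have "- x \<in> I" if "x \<in> I" for x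
    using I that minus_mem [OF one_mem] by (metis mult_minus1)
  moreover have "x * r \<in> I" if "x \<in> I" "r \<in> R" for x r
    using I that by (simp add: mult.commute)
  ultimately show "ideal I RR"
    using I by (intro idealI RR.ring_axioms RR.add.subgroupI)
      (auto simp: a_inv_def [symmetric] subset_eq)
qed

lemma idealD:
  assumes "ideal I RR"
  shows "x \<in> I \<Longrightarrow> x \<in> R" "0 \<in> I" "x \<in> I \<Longrightarrow> y \<in> I \<Longrightarrow> x + y \<in> I"
    "r \<in> R \<Longrightarrow> x \<in> I \<Longrightarrow> r * x \<in> I" "x \<in> I \<Longrightarrow> r \<in> R \<Longrightarrow> x * r \<in> I"
    "x \<in> I \<Longrightarrow> - x \<in> I" "x \<in> I \<Longrightarrow> y \<in> I \<Longrightarrow> x - y \<in> I"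
proof -
  show "x \<in> I \<Longrightarrow> x \<in> R" "0 \<in> I" "x \<in> I \<Longrightarrow> y \<in> I \<Longrightarrow> x + y \<in> I"
    and m: "\<And>r x. r \<in> R \<Longrightarrow> x \<in> I \<Longrightarrow> r * x \<in> I"
    using assms unfolding ideal_iff by blast+
  then show "x \<in> I \<Longrightarrow> r \<in> R \<Longrightarrow> x * r \<in> I" by (simp add: mult.commute)
  show minus: "x \<in> I \<Longrightarrow> - x \<in> I" for x using m [of "-1" x] by simp
  show "x \<in> I \<Longrightarrow> y \<in> I \<Longrightarrow> x - y \<in> I"
    using assms minus [of y] unfolding ideal_iff by (metis diff_conv_add_uminus)
qed

lemma ideal_eq_ring: "ideal I RR \<Longrightarrow> 1 \<in> I \<Longrightarrow> I = R"
proof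
  assume I: "ideal I RR" and "1 \<in> I"
  show "I \<subseteq> R" using idealD(1) [OF I] by blast
  show "R \<subseteq> I"
  proof
    fix x assume "x \<in> R"
    from idealD(4) [OF I this \<open>1 \<in> I\<close>] show "x \<in> I" by simp
  qed
qed

lemma primeideal_iff:
  "primeideal P RR \<longleftrightarrow> ideal P RR \<and> 1 \<notin> P \<and> (\<forall>x\<in>R. \<forall>y\<in>R. x * y \<in> P \<longrightarrow> x \<in> P \<or> y \<in> P)"
proof -
  have "R \<noteq> P \<longleftrightarrow> 1 \<notin> P" if "ideal P RR"
    using ideal_eq_ring [OF that] one_mem by blast
  then show ?thesis
    using RR.cring_axioms unfolding primeideal_def primeideal_axioms_def by simp blast
qed

lemma primeidealD:
  assumes "primeideal P RR"
  shows "ideal P RR" "1 \<notin> P" "x \<in> R \<Longrightarrow> y \<in> R \<Longrightarrow> x * y \<in> P \<Longrightarrow> x \<in> P \<or> y \<in> P"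
proof -
  note * = assms [unfolded primeideal_iff]
  show "ideal P RR" "1 \<notin> P" using * by blast+
  show "x \<in> R \<Longrightarrow> y \<in> R \<Longrightarrow> x * y \<in> P \<Longrightarrow> x \<in> P \<or> y \<in> P"
    using * by blast
qed

lemma coset_eq_image: "I +>\<^bsub>RR\<^esub> x = (\<lambda>i. i + x) ` I"
  by (auto simp: a_r_coset_def r_coset_def)

lemma coset_eq_iff:
  assumes I: "ideal I RR"
  shows "I +>\<^bsub>RR\<^esub> x = I +>\<^bsub>RR\<^esub> y \<longleftrightarrow> x - y \<in> I"
proof
  assume "I +>\<^bsub>RR\<^esub> x = I +>\<^bsub>RR\<^esub> y"
  moreover have "x \<in> I +>\<^bsub>RR\<^esub> x" using idealD(2) [OF I] by (force simp: coset_eq_image)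
  ultimately show "x - y \<in> I" by (auto simp: coset_eq_image)
next
  assume xy: "x - y \<in> I"
  then have yx: "y - x \<in> I" using idealD(6) [OF I xy] by simp
  have "i + x \<in> I +>\<^bsub>RR\<^esub> y" if "i \<in> I" for i
    unfolding coset_eq_image using idealD(3) [OF I that xy] by (intro image_eqI) auto
  moreover have "i + y \<in> I +>\<^bsub>RR\<^esub> x" if "i \<in> I" for i
    unfolding coset_eq_image using idealD(3) [OF I that yx] by (intro image_eqI) auto
  ultimately show "I +>\<^bsub>RR\<^esub> x = I +>\<^bsub>RR\<^esub> y" by (auto simp: coset_eq_image)
qed

lemma carrier_quot: "carrier (RR Quot I) = (\<lambda>x. I +>\<^bsub>RR\<^esub> x) ` R"
  by (auto simp: FactRing_def A_RCOSETS_def RCOSETS_def a_r_coset_def)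

lemma quot_simps:
  assumes "ideal I RR" "x \<in> R" "y \<in> R"
  shows "(I +>\<^bsub>RR\<^esub> x) \<otimes>\<^bsub>RR Quot I\<^esub> (I +>\<^bsub>RR\<^esub> y) = I +>\<^bsub>RR\<^esub> (x * y)"
    and "(I +>\<^bsub>RR\<^esub> x) \<oplus>\<^bsub>RR Quot I\<^esub> (I +>\<^bsub>RR\<^esub> y) = I +>\<^bsub>RR\<^esub> (x + y)"
    and "\<one>\<^bsub>RR Quot I\<^esub> = I +>\<^bsub>RR\<^esub> 1"
    and "\<zero>\<^bsub>RR Quot I\<^esub> = I +>\<^bsub>RR\<^esub> 0"
proof -
  interpret ideal I RR by fact
  show "(I +>\<^bsub>RR\<^esub> x) \<otimes>\<^bsub>RR Quot I\<^esub> (I +>\<^bsub>RR\<^esub> y) = I +>\<^bsub>RR\<^esub> (x * y)"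
    using rcoset_mult_add assms by (simp add: FactRing_def)
  show "(I +>\<^bsub>RR\<^esub> x) \<oplus>\<^bsub>RR Quot I\<^esub> (I +>\<^bsub>RR\<^esub> y) = I +>\<^bsub>RR\<^esub> (x + y)"
    using a_rcos_sum [of x y] assms by (simp add: FactRing_def)
qed (simp_all add: FactRing_def coset_eq_image)

lemma quot_cring: "ideal I RR \<Longrightarrow> cring (RR Quot I)"
  by (rule ideal.quotient_is_cring [OF _ cring_RR])

text \<open>This makes \<open>set_add RR I\<close> the reduction map from R/J to R/I, written
  without choosing representatives.\<close>

lemma coset_add_coset:
  assumes I: "ideal I RR" and J: "ideal J RR" and "J \<subseteq> I"
  shows "I <+>\<^bsub>RR\<^esub> (J +>\<^bsub>RR\<^esub> x) = I +>\<^bsub>RR\<^esub> x"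
proof -
  have "I <+>\<^bsub>RR\<^esub> (J +>\<^bsub>RR\<^esub> x) = (\<Union>i\<in>I. \<Union>j\<in>J. {i + (j + x)})"
    by (auto simp: set_add_def set_mult_def coset_eq_image)
  also have "\<dots> = (\<lambda>i. i + x) ` I"
  proof (intro equalityI subsetI)
    fix y assume "y \<in> (\<Union>i\<in>I. \<Union>j\<in>J. {i + (j + x)})"
    then obtain i j where "i \<in> I" "j \<in> J" "y = (i + j) + x" by (auto simp: add.assoc)
    then show "y \<in> (\<lambda>i. i + x) ` I" using idealD(3) [OF I] \<open>J \<subseteq> I\<close> by auto
  qed (use idealD(2) [OF J] in force)
  finally show ?thesis by (simp add: coset_eq_image)
qed

lemma ideal_principal: "a \<in> R \<Longrightarrow> ideal ((*) a ` R) RR"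
  unfolding ideal_iff
proof (intro conjI ballI)
  assume a: "a \<in> R"
  then show "(*) a ` R \<subseteq> R" by auto
  show "0 \<in> (*) a ` R" by (rule image_eqI [of _ _ 0]) auto
  fix x y assume "x \<in> (*) a ` R" "y \<in> (*) a ` R"
  then obtain u v where "x = a * u" "y = a * v" "u \<in> R" "v \<in> R" by auto
  then show "x + y \<in> (*) a ` R" by (intro image_eqI [of _ _ "u + v"]) (auto simp: algebra_simps)
next
  fix r x assume "r \<in> R" "x \<in> (*) a ` R"
  then obtain u where "x = a * u" "u \<in> R" by auto
  with \<open>r \<in> R\<close> show "r * x \<in> (*) a ` R"
    by (intro image_eqI [of _ _ "r * u"]) (auto simp: algebra_simps)
qed

lemma ideal_sum:
  assumes "ideal I RR" "\<And>x. x \<in> T \<Longrightarrow> f x \<in> I"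
  shows "(\<Sum>x\<in>T. f x) \<in> I"
  using assms(2) by (induction T rule: infinite_finite_induct) (auto intro: idealD(2,3) [OF assms(1)])

section \<open>Ideals of finite index\<close>

text \<open>Stated through representatives, so that the same \<open>F\<close> serves every set
  containing \<open>I\<close>.\<close>

definition finite_index :: "'a set \<Rightarrow> bool" where
  "finite_index I \<longleftrightarrow> (\<exists>F. finite F \<and> F \<subseteq> R \<and> (\<forall>x\<in>R. \<exists>f\<in>F. x - f \<in> I))"

lemma finite_index_mono:
  assumes "finite_index I" "I \<subseteq> J"
  shows "finite_index J"
proof -
  obtain F where F: "finite F" "F \<subseteq> R" "\<forall>x\<in>R. \<exists>f\<in>F. x - f \<in> I"
    using assms(1) unfolding finite_index_def by blast
  have "\<forall>x\<in>R. \<exists>f\<in>F. x - f \<in> J" using F(3) assms(2) by fast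
  with F(1,2) show ?thesis unfolding finite_index_def by blast
qed

lemma finite_quot:
  assumes I: "ideal I RR" and "finite_index I"
  shows "finite (carrier (RR Quot I))"
proof -
  obtain F where F: "finite F" "F \<subseteq> R" "\<forall>x\<in>R. \<exists>f\<in>F. x - f \<in> I"
    using assms unfolding finite_index_def by blast
  have "carrier (RR Quot I) \<subseteq> (\<lambda>x. I +>\<^bsub>RR\<^esub> x) ` F"
    using F coset_eq_iff [OF I] unfolding carrier_quot by blast
  then show ?thesis using F(1) by (rule finite_surj [rotated])
qed

text \<open>An element of J and its representative in \<open>F\<close> differ by an element of I,
  hence lie in J together. So J is recovered from its intersection with \<open>F\<close>.\<close>

lemma finite_ideals_above:
  assumes "finite_index I"
  shows "finite {J. ideal J RR \<and> I \<subseteq> J}"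
proof -
  obtain F where F: "finite F" "F \<subseteq> R" "\<forall>x\<in>R. \<exists>f\<in>F. x - f \<in> I"
    using assms unfolding finite_index_def by blast
  have "inj_on (\<lambda>J. J \<inter> F) {J. ideal J RR \<and> I \<subseteq> J}"
  proof (rule inj_onI)
    fix J J' assume J: "J \<in> {J. ideal J RR \<and> I \<subseteq> J}" and J': "J' \<in> {J. ideal J RR \<and> I \<subseteq> J}"
      and eq: "J \<inter> F = J' \<inter> F"
    have sub: "K \<subseteq> K'" if K: "ideal K RR" "I \<subseteq> K" and K': "ideal K' RR" "I \<subseteq> K'"
      and e: "K \<inter> F = K' \<inter> F" for K K'
    proof
      fix x assume x: "x \<in> K"
      then obtain f where f: "f \<in> F" "x - f \<in> I" using F(3) idealD(1) [OF K(1)] by blast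
      have "f \<in> K'" using idealD(7) [OF K(1) x, of "x - f"] f K e by auto
      then have "(x - f) + f \<in> K'" using f K' by (intro idealD(3)) auto
      then show "x \<in> K'" by simp
    qed
    show "J = J'" using sub [of J J'] sub [of J' J] J J' eq by blast
  qed
  moreover have "(\<lambda>J. J \<inter> F) ` {J. ideal J RR \<and> I \<subseteq> J} \<subseteq> Pow F" by auto
  ultimately show ?thesis using F(1) by (meson finite_Pow_iff finite_imageD finite_subset)
qed

text \<open>Meant for powers, possibly times a constant: the relations between two powers give
  inverses modulo primes and integral equations for fractions.\<close>

lemma finite_index_pigeonhole:
  fixes s :: "nat \<Rightarrow> 'a"
  assumes I: "ideal I RR" and fi: "finite_index I" and s: "\<And>n. s n \<in> R"
  obtains i j where "i < j" "s j - s i \<in> I"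
proof -
  have "\<not> inj (\<lambda>n. I +>\<^bsub>RR\<^esub> s n)"
  proof
    assume "inj (\<lambda>n. I +>\<^bsub>RR\<^esub> s n)"
    moreover have "range (\<lambda>n. I +>\<^bsub>RR\<^esub> s n) \<subseteq> carrier (RR Quot I)"
      using s by (auto simp: carrier_quot)
    ultimately show False
      using finite_quot [OF I fi] by (metis finite_imageD finite_subset infinite_UNIV_nat)
  qed
  then obtain i j where ij: "i \<noteq> j" "I +>\<^bsub>RR\<^esub> s i = I +>\<^bsub>RR\<^esub> s j" by (auto simp: inj_def)
  then have "s i - s j \<in> I" "s j - s i \<in> I" using coset_eq_iff [OF I] by metis+
  with ij(1) that show thesis by (meson linorder_neqE_nat)
qed

section \<open>Prime ideals of finite index\<close>

text \<open>Two powers x^i and x^j agree modulo P. Cancelling x^i, which is outside the prime P,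
  leaves x^(j-i) = 1 modulo P, so x^(j-i-1) is an inverse.\<close>

lemma prime_inverse:
  assumes P: "primeideal P RR" and fi: "finite_index P" and x: "x \<in> R" "x \<notin> P"
  obtains y where "y \<in> R" "1 - x * y \<in> P"
proof -
  obtain i j where ij: "i < j" "x ^ j - x ^ i \<in> P"
    using finite_index_pigeonhole [OF primeidealD(1) [OF P] fi, of "\<lambda>n. x ^ n"] x by auto
  define d where "d = j - i - 1"
  have "x ^ j = x ^ i * (x * x ^ d)"
    using ij(1) by (simp add: d_def flip: power_add power_Suc)
  then have "x ^ i * (x * x ^ d - 1) \<in> P" using ij(2) by (simp add: right_diff_distrib)
  moreover have "x ^ n \<notin> P" for n
    using x primeidealD(2) [OF P] by (induction n) (auto dest: primeidealD(3) [OF P, rotated -1])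
  ultimately have "x * x ^ d - 1 \<in> P"
    using primeidealD(3) [OF P, of "x ^ i" "x * x ^ d - 1"] x by auto
  then have "1 - x * x ^ d \<in> P"
    using idealD(6) [OF primeidealD(1) [OF P]] by (metis minus_diff_eq)
  with x that [of "x ^ d"] show thesis by simp
qed

lemma prime_maximal:
  assumes P: "primeideal P RR" and fi: "finite_index P" and J: "ideal J RR" "P \<subseteq> J" "J \<noteq> P"
  shows "J = R"
proof -
  obtain x where x: "x \<in> J" "x \<notin> P" using J by blast
  then obtain y where y: "y \<in> R" "1 - x * y \<in> P"
    using prime_inverse [OF P fi, of x] idealD(1) [OF J(1)] by blast
  have "(1 - x * y) + x * y \<in> J" using x y J idealD(5) [OF J(1)] by (intro idealD(3)) auto
  then show ?thesis using ideal_eq_ring [OF J(1)] by simp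
qed

lemma quot_prime_field:
  assumes "primeideal P RR" "finite_index P"
  shows "field (RR Quot P)"
proof -
  have "maximalideal P RR"
    using assms prime_maximal [OF assms] primeidealD [OF assms(1)]
    by (auto simp: maximalideal_def maximalideal_axioms_def)
  then show ?thesis by (rule maximalideal.quotient_is_field [OF _ cring_RR])
qed

lemma ideal_add_principal:
  assumes I: "ideal I RR" and x: "x \<in> R"
  shows "ideal {i + r * x |i r. i \<in> I \<and> r \<in> R} RR"
  unfolding ideal_iff
proof (intro conjI ballI subsetI)
  show "0 \<in> {i + r * x |i r. i \<in> I \<and> r \<in> R}"
    using idealD(2) [OF I] by (intro CollectI exI [of _ 0]) auto
next
  fix y z assume "y \<in> {i + r * x |i r. i \<in> I \<and> r \<in> R}" "z \<in> {i + r * x |i r. i \<in> I \<and> r \<in> R}"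
  then obtain i r i' r' where *: "y = i + r * x" "z = i' + r' * x" "i \<in> I" "r \<in> R" "i' \<in> I" "r' \<in> R"
    by blast
  then show "y + z \<in> {i + r * x |i r. i \<in> I \<and> r \<in> R}"
    using idealD(3) [OF I]
    by (intro CollectI exI [of _ "i + i'"] exI [of _ "r + r'"]) (auto simp: algebra_simps)
next
  fix s y assume s: "s \<in> R" and "y \<in> {i + r * x |i r. i \<in> I \<and> r \<in> R}"
  then obtain i r where *: "y = i + r * x" "i \<in> I" "r \<in> R" by blast
  moreover have "s * y = s * i + (s * r) * x" using * by (simp add: algebra_simps)
  ultimately show "s * y \<in> {i + r * x |i r. i \<in> I \<and> r \<in> R}"
    using s idealD(4) [OF I] mult_mem by blast
qed (use x idealD(1) [OF I] in auto)

text \<open>Finitely many ideals lie above I, so one is maximal among those without 1. It is prime,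
  since adding to it any further element of R produces 1.\<close>

lemma ex_prime_above:
  assumes I: "ideal I RR" and fi: "finite_index I" and "1 \<notin> I"
  obtains P where "primeideal P RR" "I \<subseteq> P"
proof -
  let ?X = "{J. ideal J RR \<and> I \<subseteq> J \<and> 1 \<notin> J}"
  have "finite ?X" by (rule finite_subset [OF _ finite_ideals_above [OF fi]]) auto
  moreover have "I \<in> ?X" using assms by auto
  ultimately obtain P where P: "P \<in> ?X" and max: "\<And>J. J \<in> ?X \<Longrightarrow> P \<subseteq> J \<Longrightarrow> J = P"
    by (metis (no_types, lifting) empty_iff finite_has_maximal)
  have idP: "ideal P RR" using P by simp
  have inv: "\<exists>p\<in>P. \<exists>r\<in>R. 1 = p + r * x" if x: "x \<in> R" "x \<notin> P" for x
  proof (rule ccontr)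
    assume contr: "\<not> ?thesis"
    let ?J = "{i + r * x |i r. i \<in> P \<and> r \<in> R}"
    have "P \<subseteq> ?J"
    proof
      fix p assume "p \<in> P"
      then show "p \<in> ?J" by (intro CollectI exI [of _ p] exI [of _ 0]) auto
    qed
    moreover have "?J \<in> ?X" using ideal_add_principal [OF idP x(1)] P contr calculation by auto
    ultimately have "?J = P" using max by blast
    moreover have "x \<in> ?J" using idealD(2) [OF idP] by (intro CollectI exI [of _ 0] exI [of _ 1]) auto
    ultimately show False using x by simp
  qed
  have "x \<in> P \<or> y \<in> P" if xy: "x \<in> R" "y \<in> R" "x * y \<in> P" for x y
  proof (rule ccontr)
    assume "\<not> ?thesis"
    then obtain p r where pr: "p \<in> P" "r \<in> R" "1 = p + r * x" and y: "y \<notin> P"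
      using inv [OF xy(1)] by blast
    \<comment> \<open>This is y times the relation 1 = p + r x, arranged so that both terms lie in
      P.\<close>
    have "y * p + r * (x * y) \<in> P"
      using pr xy idealD(4) [OF idP] by (intro idealD(3) [OF idP]) auto
    also have "y * p + r * (x * y) = y * (p + r * x)" by (simp add: algebra_simps)
    finally show False using y pr(3) by simp
  qed
  with P have "primeideal P RR" unfolding primeideal_iff by blast
  with P that show thesis by blast
qed

text \<open>Each P gets an element \<open>e P\<close> that is 1 modulo P and 0 modulo the other
  primes; the sum of the \<open>b P * e P\<close> then solves all congruences.\<close>

lemma primes_crt:
  assumes fin: "finite S" and S: "\<And>P. P \<in> S \<Longrightarrow> primeideal P RR \<and> finite_index P"
    and b: "\<And>P. P \<in> S \<Longrightarrow> b P \<in> R"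
  shows "\<exists>x\<in>R. \<forall>P\<in>S. x - b P \<in> P"
proof -
  have "\<exists>e\<in>R. 1 - e \<in> P \<and> (\<forall>Q\<in>S - {P}. e \<in> Q)" if P: "P \<in> S" for P
  proof -
    note PI = primeidealD(1) [OF S [OF P, THEN conjunct1]]
    have "\<exists>e\<in>R. 1 - e \<in> P \<and> (\<forall>Q\<in>T. e \<in> Q)" if "T \<subseteq> S - {P}" for T
      using finite_subset [OF that finite_Diff [OF fin]] that
    proof (induction T rule: finite_induct)
      case empty
      then show ?case using idealD(2) [OF PI] by (intro bexI [of _ 1]) auto
    next
      case (insert Q T)
      then obtain e where e: "e \<in> R" "1 - e \<in> P" "\<forall>Q\<in>T. e \<in> Q" by auto
      have Q: "Q \<in> S" "Q \<noteq> P" using insert.prems by auto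
      note QI = primeidealD(1) [OF S [OF Q(1), THEN conjunct1]]
      \<comment> \<open>Distinct primes of finite index are maximal, so neither contains the other.
        Some q in Q is therefore invertible modulo P, with inverse y.\<close>
      have "\<not> Q \<subseteq> P"
        using prime_maximal [of Q P] S [OF P] S [OF Q(1)] Q(2) PI primeidealD(2) by (metis one_mem)
      then obtain q where q: "q \<in> Q" "q \<notin> P" by blast
      have qR: "q \<in> R" using idealD(1) [OF QI q(1)] .
      obtain y where y: "y \<in> R" "1 - q * y \<in> P"
        using prime_inverse [of P q] S [OF P] q qR by blast
      \<comment> \<open>Multiplying e by q y puts it into Q; both factors are 1 modulo P, hence so
        is the product.\<close>
      have "(1 - e) + e * (1 - q * y) \<in> P"
        using e y idealD(4) [OF PI] by (intro idealD(3) [OF PI]) auto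
      then have "1 - e * (q * y) \<in> P" by (simp add: algebra_simps)
      moreover have "e * (q * y) \<in> Q"
        using e y q idealD(4,5) [OF QI] by blast
      moreover have "e * (q * y) \<in> Q'" if "Q' \<in> T" for Q'
        using e y qR that idealD(5) [OF primeidealD(1) [of Q']] S [of Q'] insert.prems by auto
      ultimately show ?case using e y qR by (intro bexI [of _ "e * (q * y)"]) auto
    qed
    then show ?thesis by blast
  qed
  then obtain e where e: "\<And>P. P \<in> S \<Longrightarrow> e P \<in> R \<and> 1 - e P \<in> P \<and> (\<forall>Q\<in>S - {P}. e P \<in> Q)"
    by metis
  define x where "x = (\<Sum>P\<in>S. b P * e P)"
  have "x \<in> R" unfolding x_def
    by (rule ideal_sum) (use b e RR.oneideal in auto)
  moreover have "x - b P \<in> P" if P: "P \<in> S" for P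
  proof -
    note PI = primeidealD(1) [OF S [OF P, THEN conjunct1]]
    have "x - b P = (\<Sum>Q\<in>S - {P}. b Q * e Q) - b P * (1 - e P)"
      unfolding x_def using P fin by (subst sum.remove [of S P]) (auto simp: algebra_simps)
    also have "\<dots> \<in> P"
      using b e P by (intro idealD(7) [OF PI] ideal_sum [OF PI]) (auto intro!: idealD(4) [OF PI])
    finally show ?thesis .
  qed
  ultimately show ?thesis by blast
qed

text \<open>Invertibility of x modulo I means that I + Rx contains 1; if it does not, some prime
  contains I + Rx.\<close>

lemma coset_Units_iff:
  assumes I: "ideal I RR" and fi: "finite_index I" and x: "x \<in> R"
  shows "I +>\<^bsub>RR\<^esub> x \<in> Units (RR Quot I) \<longleftrightarrow> (\<forall>P. primeideal P RR \<and> I \<subseteq> P \<longrightarrow> x \<notin> P)"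
proof -
  interpret Q: cring "RR Quot I" by (rule quot_cring [OF I])
  have "I +>\<^bsub>RR\<^esub> x \<in> Units (RR Quot I) \<longleftrightarrow>
      (\<exists>y\<in>R. (I +>\<^bsub>RR\<^esub> x) \<otimes>\<^bsub>RR Quot I\<^esub> (I +>\<^bsub>RR\<^esub> y) = \<one>\<^bsub>RR Quot I\<^esub>)"
    using x Q.m_comm unfolding Units_def carrier_quot by (auto 4 4)
  also have "\<dots> \<longleftrightarrow> (\<exists>y\<in>R. x * y - 1 \<in> I)"
    using x by (simp add: quot_simps(1) [OF I] quot_simps(3) [OF I one_mem one_mem] coset_eq_iff [OF I])
  also have "\<dots> \<longleftrightarrow> (\<forall>P. primeideal P RR \<and> I \<subseteq> P \<longrightarrow> x \<notin> P)"
  proof safe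
    fix y P assume y: "y \<in> R" "x * y - 1 \<in> I" and P: "primeideal P RR" "I \<subseteq> P" "x \<in> P"
    note PI = primeidealD(1) [OF P(1)]
    have "x * y - (x * y - 1) \<in> P"
      using idealD(7) [OF PI idealD(5) [OF PI], of x y "x * y - 1"] y P by blast
    then show False using primeidealD(2) [OF P(1)] by simp
  next
    assume *: "\<forall>P. primeideal P RR \<and> I \<subseteq> P \<longrightarrow> x \<notin> P"
    let ?J = "{i + r * x |i r. i \<in> I \<and> r \<in> R}"
    have J: "ideal ?J RR" by (rule ideal_add_principal [OF I x])
    have IJ: "I \<subseteq> ?J"
    proof
      fix p assume "p \<in> I"
      then show "p \<in> ?J" by (intro CollectI exI [of _ p] exI [of _ 0]) auto
    qed
    have xJ: "x \<in> ?J" using idealD(2) [OF I] by (intro CollectI exI [of _ 0] exI [of _ 1]) auto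
    have "1 \<in> ?J"
    proof (rule ccontr)
      assume "1 \<notin> ?J"
      then obtain P where "primeideal P RR" "?J \<subseteq> P"
        by (rule ex_prime_above [OF J finite_index_mono [OF fi IJ]])
      with * IJ xJ show False by (meson subset_iff)
    qed
    then obtain i r where ir: "1 = i + r * x" "i \<in> I" "r \<in> R" by blast
    then have "x * r - 1 = - i" by (simp add: algebra_simps)
    then have "x * r - 1 \<in> I" using idealD(6) [OF I ir(2)] by (simp only:)
    then show "\<exists>y\<in>R. x * y - 1 \<in> I" using ir(3) by blast
  qed
  finally show ?thesis .
qed

end

section \<open>For prime ideals, to contain is to divide\<close>

text \<open>The two properties of rings of integers behind the invertibility of primes.
  \<open>integrally_closed\<close> concerns the equations t^j - t^i = r with r in R, the shape that
  the pigeonhole principle produces.\<close>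

locale residually_finite_subring = field_subring +
  assumes finite_index_principal: "a \<in> R \<Longrightarrow> a \<noteq> 0 \<Longrightarrow> finite_index ((*) a ` R)"
    and integrally_closed:
      "a \<in> R \<Longrightarrow> b \<in> R \<Longrightarrow> a \<noteq> 0 \<Longrightarrow> i < j \<Longrightarrow> (b / a) ^ j - (b / a) ^ i \<in> R \<Longrightarrow> b / a \<in> R"
begin

lemma finite_index_ideal:
  assumes I: "ideal I RR" and "I \<noteq> {0}"
  shows "finite_index I"
proof -
  obtain a where a: "a \<in> I" "a \<noteq> 0" using assms idealD(2) [OF I] by blast
  have "(*) a ` R \<subseteq> I" using a idealD(5) [OF I] by auto
  then show ?thesis
    using finite_index_principal [of a] a idealD(1) [OF I] finite_index_mono by blast
qed

text \<open>Provides the fraction b/a outside R that multiplies P into R. For this the class of b in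
  R/aR must be nonzero and killed by P; b is chosen so that its annihilator is maximal among those
  contained in P.\<close>

lemma prime_annihilator:
  assumes P: "primeideal P RR" and a: "a \<in> P" "a \<noteq> 0"
  obtains b where "b \<in> R" "b \<notin> (*) a ` R" "\<And>p. p \<in> P \<Longrightarrow> b * p \<in> (*) a ` R"
proof -
  note PI = primeidealD(1) [OF P]
  define A where "A = (*) a ` R"
  have aR: "a \<in> R" using idealD(1) [OF PI a(1)] .
  have A: "ideal A RR" unfolding A_def by (rule ideal_principal [OF aR])
  have fi: "finite_index A" unfolding A_def by (rule finite_index_principal [OF aR a(2)])
  have AP: "A \<subseteq> P" unfolding A_def using idealD(5) [OF PI a(1)] by auto
  \<comment> \<open>The annihilator of the class of b in R/aR.\<close>
  define ann where "ann b = {r \<in> R. r * b \<in> A}" for b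
  have ann_ideal: "ideal (ann b) RR" "A \<subseteq> ann b" if "b \<in> R" for b
    unfolding ideal_iff ann_def using that idealD [OF A]
    by (auto simp: distrib_right mult.assoc)
  \<comment> \<open>A maximal annihilator contained in \<open>P\<close> equals \<open>P\<close>.\<close>
  let ?X = "{J. \<exists>b\<in>R. J = ann b \<and> J \<subseteq> P}"
  have "finite ?X"
    by (rule finite_subset [OF _ finite_ideals_above [OF fi]]) (use ann_ideal in auto)
  moreover have "ann 1 \<in> ?X" using AP by (auto simp: ann_def intro!: bexI [of _ 1])
  ultimately obtain M where M: "M \<in> ?X" and max: "\<And>J. J \<in> ?X \<Longrightarrow> M \<subseteq> J \<Longrightarrow> J = M"
    by (metis (no_types, lifting) empty_iff finite_has_maximal)
  then obtain b where b: "b \<in> R" "ann b \<subseteq> P" "M = ann b" by blast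
  have max: "ann (b * c) = ann b" if "c \<in> R" "ann (b * c) \<subseteq> P" for c
  proof -
    have "ann b \<subseteq> ann (b * c)"
      using idealD(5) [OF A] that(1) by (auto simp: ann_def mult.assoc [symmetric])
    moreover have "ann (b * c) \<in> ?X" using that b(1) mult_mem by blast
    ultimately show ?thesis using max [of "ann (b * c)"] b(3) by blast
  qed
  \<comment> \<open>If t x kills b, then x kills b t. As t is outside P, the annihilator of b t
    stays inside P, so by maximality it is that of b.\<close>
  have cancel: "x \<in> ann b" if "t \<in> R" "t \<notin> P" "x \<in> R" "t \<in> ann (b * x)" for t x
  proof -
    have "ann (b * t) \<subseteq> P"
    proof
      fix r assume "r \<in> ann (b * t)"
      then have "r \<in> R" "r * t \<in> ann b" using that(1) by (auto simp: ann_def ac_simps)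
      then show "r \<in> P" using b(2) primeidealD(3) [OF P, of r t] that(1,2) by blast
    qed
    from max [OF that(1) this] show ?thesis using that(3,4) by (auto simp: ann_def ac_simps)
  qed
  have "x \<in> ann b" if x: "x \<in> P" for x
  proof (rule ccontr)
    assume nx: "x \<notin> ann b"
    have xR: "x \<in> R" using idealD(1) [OF PI x] .
    \<comment> \<open>If b y is nonzero in R/aR, \<open>cancel\<close> keeps its annihilator inside
      P, and maximality applies.\<close>
    have eq: "ann (b * y) = ann b" if "y \<in> R" "y \<notin> ann b" for y
    proof (rule max [OF that(1)], rule subsetI, rule ccontr)
      fix t assume "t \<in> ann (b * y)" "t \<notin> P"
      then show False using cancel [of t y] that by (auto simp: ann_def)
    qed
    have np: "x ^ n \<notin> ann b" for n
    proof (induction n)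
      case 0
      then show ?case using b(2) primeidealD(2) [OF P] by auto
    next
      case (Suc n)
      then have "x \<notin> ann (b * x ^ n)" using nx eq [of "x ^ n"] xR by simp
      then show ?case using xR by (simp add: ann_def ac_simps)
    qed
    \<comment> \<open>Two powers of x agree modulo aR, so x^(j-i) - 1 kills b x^i and lies in P. As
      x is in P too, this puts 1 into P.\<close>
    obtain i j where ij: "i < j" "x ^ j - x ^ i \<in> A"
      using finite_index_pigeonhole [OF A fi, of "\<lambda>n. x ^ n"] xR by auto
    define d where "d = j - i - 1"
    have "x ^ j = x ^ i * (x * x ^ d)"
      using ij(1) by (simp add: d_def flip: power_add power_Suc)
    then have "(x * x ^ d - 1) * x ^ i \<in> A" using ij(2) by (simp add: algebra_simps)
    from idealD(4) [OF A b(1) this] have "x * x ^ d - 1 \<in> ann (b * x ^ i)"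
      using xR by (simp add: ann_def ac_simps)
    then have "x * x ^ d - 1 \<in> P" using eq [of "x ^ i"] np xR b(2) by auto
    then have "x * x ^ d - (x * x ^ d - 1) \<in> P"
      using idealD(7) [OF PI idealD(5) [OF PI x, of "x ^ d"]] power_mem [OF xR] by blast
    then show False using primeidealD(2) [OF P] by simp
  qed
  moreover have "b \<notin> A"
  proof
    assume "b \<in> A"
    then have "1 \<in> ann b" by (simp add: ann_def)
    then show False using b(2) primeidealD(2) [OF P] by blast
  qed
  ultimately show thesis using that [of b] b(1) by (auto simp: ann_def A_def ac_simps)
qed

text \<open>With g = b/a, all g^n c stay in I and so in R. Two of them agree modulo cR, and
  cancelling c leaves g^j - g^i in R.\<close>

lemma integral_multiplier:
  assumes I: "ideal I RR" and c: "c \<in> I" "c \<noteq> 0"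
    and a: "a \<in> R" "a \<noteq> 0" and b: "b \<in> R"
    and mult: "\<And>x. x \<in> I \<Longrightarrow> b / a * x \<in> I"
  shows "b / a \<in> R"
proof -
  define g where "g = b / a"
  have cR: "c \<in> R" by (rule idealD(1) [OF I c(1)])
  have mem: "g ^ n * c \<in> I" for n
  proof (induction n)
    case (Suc n)
    then show ?case using mult [folded g_def] by (simp add: mult.assoc)
  qed (use c in simp)
  then have "g ^ n * c \<in> R" for n by (rule idealD(1) [OF I])
  then obtain i j where ij: "i < j" "g ^ j * c - g ^ i * c \<in> (*) c ` R"
    using finite_index_pigeonhole [OF ideal_principal [OF cR] finite_index_principal [OF cR c(2)],
        of "\<lambda>n. g ^ n * c"] by blast
  then obtain r where r: "r \<in> R" "g ^ j * c - g ^ i * c = c * r" by blast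
  then have "(g ^ j - g ^ i) * c = r * c" by (simp only: left_diff_distrib mult.commute [of c])
  then have "g ^ j - g ^ i = r" using c(2) by simp
  then show ?thesis using integrally_closed [OF a(1) b a(2) ij(1)] r(1) by (simp only: g_def)
qed

text \<open>Containment gives divisibility because P is invertible: for g = b/a from
  \<open>prime_annihilator\<close>, gP lies in R and 1 lies in P + gP, so R + gR is an inverse of
  P.\<close>

lemma prime_dvd_iff:
  assumes P: "primeideal P RR" and I: "ideal I RR" and "I \<noteq> {0}"
  shows "ideal_dvd RR P I \<longleftrightarrow> I \<subseteq> P"
proof
  note PI = primeidealD(1) [OF P]
  assume "ideal_dvd RR P I"
  then show "I \<subseteq> P" unfolding ideal_dvd_def using RR.ideal_prod_inter [OF PI] by blast
next
  note PI = primeidealD(1) [OF P]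
  assume IP: "I \<subseteq> P"
  obtain a where a: "a \<in> P" "a \<noteq> 0" using \<open>I \<noteq> {0}\<close> IP idealD(2) [OF I] by blast
  have aR: "a \<in> R" using idealD(1) [OF PI a(1)] .
  obtain b where b: "b \<in> R" "b \<notin> (*) a ` R" "\<And>p. p \<in> P \<Longrightarrow> b * p \<in> (*) a ` R"
    using prime_annihilator [OF P a] by blast
  define g where "g = b / a"
  have gR: "g \<notin> R"
  proof
    assume "g \<in> R"
    then have "a * g \<in> (*) a ` R" by blast
    then show False using b(2) a(2) by (simp add: g_def)
  qed
  have gP: "g * p \<in> R" if p: "p \<in> P" for p
  proof -
    obtain r where r: "r \<in> R" "b * p = a * r" using b(3) [OF p] by blast
    then have "g * p = r" using a(2) by (simp add: g_def)
    with r show ?thesis by simp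
  qed
  \<comment> \<open>If g mapped P into itself, g would lie in R. So some g p0 is in R but outside P,
    hence invertible modulo P.\<close>
  obtain p0 where p0: "p0 \<in> P" "g * p0 \<notin> P"
    using integral_multiplier [OF PI a aR a(2) b(1)] gR unfolding g_def by blast
  obtain y where y: "y \<in> R" "1 - (g * p0) * y \<in> P"
    using prime_inverse [OF P finite_index_ideal [OF PI] gP [OF p0(1)] p0(2)] a by blast
  \<comment> \<open>The colon ideal (I : P), to serve as the cofactor of P.\<close>
  define L where "L = {x \<in> R. \<forall>p\<in>P. x * p \<in> I}"
  have L: "ideal L RR"
    unfolding ideal_iff L_def using idealD [OF I] by (auto simp: distrib_right mult.assoc)
  have "I \<subseteq> ideal_prod RR P L"
  proof
    fix x assume x: "x \<in> I"
    have xR: "x \<in> R" using idealD(1) [OF I x] .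
    have "x \<in> L" unfolding L_def using xR x idealD(5) [OF I x] idealD(1) [OF PI] by blast
    moreover have "g * x \<in> L"
    proof -
      have "g * x * p \<in> I" if "p \<in> P" for p
        using idealD(4) [OF I gP [OF that] x] by (simp add: ac_simps)
      then show ?thesis using gP x IP by (simp add: L_def subset_iff)
    qed
    moreover have "p0 * y \<in> P" using p0 y idealD(5) [OF PI] by blast
    \<comment> \<open>The identity 1 = (1 - g p0 y) + (p0 y) g is multiplied by x; in both products
      the first factor is in P and the second in L.\<close>
    ultimately have "(1 - (g * p0) * y) \<otimes>\<^bsub>RR\<^esub> x \<oplus>\<^bsub>RR\<^esub> (p0 * y) \<otimes>\<^bsub>RR\<^esub> (g * x) \<in> ideal_prod RR P L"
      by (intro ideal_prod.sum ideal_prod.prod y(2))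
    moreover have "(1 - (g * p0) * y) \<otimes>\<^bsub>RR\<^esub> x \<oplus>\<^bsub>RR\<^esub> (p0 * y) \<otimes>\<^bsub>RR\<^esub> (g * x) = x"
      by (simp add: algebra_simps)
    ultimately show "x \<in> ideal_prod RR P L" by (simp only:)
  qed
  moreover have "ideal_prod RR P L \<subseteq> I"
  proof
    fix x assume "x \<in> ideal_prod RR P L"
    then show "x \<in> I"
      by induction (use idealD(3) [OF I] in \<open>auto simp: L_def mult.commute\<close>)
  qed
  ultimately show "ideal_dvd RR P I" unfolding ideal_dvd_def using L by blast
qed

lemma prime_ideal_divisors_eq:
  assumes "ideal I RR" "I \<noteq> {0}"
  shows "prime_ideal_divisors RR I = {P. primeideal P RR \<and> I \<subseteq> P}"
  using prime_dvd_iff [OF _ assms] by (auto simp: prime_ideal_divisors_def)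

theorem gen_ideal_totient_eq:
  assumes I: "ideal I RR" "I \<noteq> {0}" and k: "k > 0"
  shows "real (gen_ideal_totient RR k I) = real (ideal_totient RR I) ^ k *
           (\<Prod>P\<in>prime_ideal_divisors RR I.
              \<Sum>j=0..k-1. (-1) ^ j / (real (ideal_norm RR P) - 1) ^ j)"
proof -
  let ?S = "{P. primeideal P RR \<and> I \<subseteq> P}"
  have fi: "finite_index I" by (rule finite_index_ideal [OF I])
  have fiP: "finite_index P" if "P \<in> ?S" for P
    using that by (intro finite_index_mono [OF fi]) simp
  have finS: "finite ?S"
    by (rule finite_subset [OF _ finite_ideals_above [OF fi]]) (use primeidealD(1) in auto)
  have SI: "ideal P RR" if "P \<in> ?S" for P using that primeidealD(1) by blast
  have h: "set_add RR P (I +>\<^bsub>RR\<^esub> x) = P +>\<^bsub>RR\<^esub> x" if "P \<in> ?S" for P x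
    using coset_add_coset [OF SI [OF that] I(1)] that by blast
  \<comment> \<open>The indices are the primes containing I, which by
    \<open>prime_ideal_divisors_eq\<close> are its prime divisors; reduction adds P to a coset of
    I.\<close>
  interpret residue_fields "RR Quot I" "\<lambda>P. RR Quot P" "set_add RR" ?S
  proof (rule residue_fields.intro)
    show "cring (RR Quot I)" by (rule quot_cring [OF I(1)])
    show "finite (carrier (RR Quot I))" by (rule finite_quot [OF I(1) fi])
    show "finite ?S" by (rule finS)
    show "field (RR Quot P)" if "P \<in> ?S" for P using quot_prime_field fiP [OF that] that by blast
    show "set_add RR P \<in> ring_hom (RR Quot I) (RR Quot P)" if P: "P \<in> ?S" for P
      by (rule ring_hom_memI)
        (auto simp: carrier_quot h [OF P] quot_simps(1,2) [OF I(1)] quot_simps(1,2) [OF SI [OF P]]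
          quot_simps(3) [OF I(1) one_mem one_mem] quot_simps(3) [OF SI [OF P] one_mem one_mem])
    show "\<exists>Y\<in>carrier (RR Quot I). \<forall>P\<in>?S. set_add RR P Y = b P"
      if b: "\<And>P. P \<in> ?S \<Longrightarrow> b P \<in> carrier (RR Quot P)" for b
    proof -
      have "\<exists>x. \<forall>P\<in>?S. x P \<in> R \<and> b P = P +>\<^bsub>RR\<^esub> x P"
        using b unfolding carrier_quot by (intro bchoice) blast
      then obtain x where x: "\<And>P. P \<in> ?S \<Longrightarrow> x P \<in> R" "\<And>P. P \<in> ?S \<Longrightarrow> b P = P +>\<^bsub>RR\<^esub> x P"
        by blast
      obtain y where y: "y \<in> R" "\<forall>P\<in>?S. y - x P \<in> P"
        using primes_crt [OF finS, of x] fiP x by blast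
      have "set_add RR P (I +>\<^bsub>RR\<^esub> y) = b P" if "P \<in> ?S" for P
        using h [OF that] x(2) [OF that] coset_eq_iff [OF SI [OF that]] y(2) that by metis
      then show ?thesis using y(1) unfolding carrier_quot by blast
    qed
    show "Y \<in> Units (RR Quot I) \<longleftrightarrow> (\<forall>P\<in>?S. set_add RR P Y \<noteq> \<zero>\<^bsub>RR Quot P\<^esub>)"
      if "Y \<in> carrier (RR Quot I)" for Y
    proof -
      obtain x where x: "x \<in> R" "Y = I +>\<^bsub>RR\<^esub> x" using \<open>Y \<in> _\<close> unfolding carrier_quot by blast
      have "set_add RR P Y = \<zero>\<^bsub>RR Quot P\<^esub> \<longleftrightarrow> x \<in> P" if "P \<in> ?S" for P
        using h [OF that, of x] x(2) coset_eq_iff [OF SI [OF that], of x 0]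
        by (simp add: quot_simps(4) [OF SI [OF that] zero_mem zero_mem])
      then show ?thesis unfolding x(2) coset_Units_iff [OF I(1) fi x(1)] by blast
    qed
  qed
  show ?thesis
    unfolding gen_ideal_totient_def ideal_totient_def ideal_norm_def
      prime_ideal_divisors_eq [OF I] by (rule card_unit_tuples [OF k])
qed

end

section \<open>Finiteness of the quotients\<close>

lemma (in field_subring) of_nat_mem [simp]: "of_nat n \<in> R"
  by (induction n) auto

lemma (in field_subring) of_int_mem [simp]: "of_int n \<in> R"
  by (cases n rule: int_cases2) auto

text \<open>Expansion in two digits: x = f + a y and then y = g + b z, so the f + a g represent all
  classes modulo ab.\<close>

lemma (in field_subring) finite_index_mult:
  assumes a: "a \<in> R" "finite_index ((*) a ` R)" and b: "b \<in> R" "finite_index ((*) b ` R)"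
  shows "finite_index ((*) (a * b) ` R)"
proof -
  obtain F where F: "finite F" "F \<subseteq> R" "\<forall>x\<in>R. \<exists>f\<in>F. x - f \<in> (*) a ` R"
    using a(2) unfolding finite_index_def by blast
  obtain G where G: "finite G" "G \<subseteq> R" "\<forall>x\<in>R. \<exists>f\<in>G. x - f \<in> (*) b ` R"
    using b(2) unfolding finite_index_def by blast
  have "\<exists>h\<in>(\<lambda>(f, g). f + a * g) ` (F \<times> G). x - h \<in> (*) (a * b) ` R" if x: "x \<in> R" for x
  proof -
    obtain f y where f: "f \<in> F" "y \<in> R" "x - f = a * y" using F(3) x by blast
    obtain g z where g: "g \<in> G" "z \<in> R" "y - g = b * z" using G(3) f(2) by blast
    have "x = f + a * y" "y = g + b * z" using f(3) g(3) by (simp_all add: algebra_simps)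
    then have "x - (f + a * g) = (a * b) * z" by (simp add: algebra_simps)
    then have "x - (f + a * g) \<in> (*) (a * b) ` R" using g(2) by blast
    with f(1) g(1) show ?thesis by (intro bexI [of _ "f + a * g"]) auto
  qed
  moreover have "(\<lambda>(f, g). f + a * g) ` (F \<times> G) \<subseteq> R" using F(2) G(2) a(1)
    by (auto simp: subset_iff)
  moreover have "finite ((\<lambda>(f, g). f + a * g) ` (F \<times> G))" using F(1) G(1) by simp
  ultimately show ?thesis unfolding finite_index_def by meson
qed

section \<open>Integer relations from rational dependence\<close>

interpretation rat_vs: vector_space "\<lambda>(q::rat) (x::'a::field_char_0). of_rat q * x"
  by unfold_locales (simp_all add: algebra_simps of_rat_add of_rat_mult)

lemma common_denominator:
  assumes "finite U"
  shows "\<exists>D>0. \<forall>v\<in>U. \<exists>c. of_int D * (q v :: rat) = of_int c"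
  using assms
proof induction
  case empty
  show ?case by (intro exI [of _ 1]) auto
next
  case (insert v U)
  then obtain D where D: "D > 0" "\<forall>v\<in>U. \<exists>c. of_int D * q v = of_int c" by blast
  obtain a b where ab: "q v = Rat.Fract a b" "b > 0" by (cases "q v") auto
  then have b: "of_int b * q v = of_int a" by (simp add: Fract_of_int_quotient)
  have "\<exists>c. of_int (D * b) * q w = of_int c" if "w \<in> insert v U" for w
  proof (cases "w = v")
    case True
    have "of_int (D * b) * q v = of_int (D * a)" using b by (simp add: mult.assoc)
    with True show ?thesis by blast
  next
    case False
    then have "w \<in> U" using that by simp
    with D(2) obtain c where "of_int D * q w = of_int c" by metis
    then have "of_int (D * b) * q w = of_int (c * b)" by (simp add: mult.commute mult.left_commute)
    then show ?thesis by (rule exI)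
  qed
  with D(1) ab(2) show ?case by (intro exI [of _ "D * b"]) auto
qed

text \<open>Clearing denominators gives coefficients whose divisibility by powers of a prime can be
  studied.\<close>

lemma rat_dependent_imp_int:
  fixes U :: "'a :: field_char_0 set"
  assumes "finite U" "rat_vs.dependent U"
  obtains c :: "'a \<Rightarrow> int" and v where "v \<in> U" "c v \<noteq> 0" "(\<Sum>u\<in>U. of_int (c u) * u) = 0"
proof -
  obtain q :: "'a \<Rightarrow> rat" and v where q: "v \<in> U" "q v \<noteq> 0" "(\<Sum>u\<in>U. of_rat (q u) * u) = 0"
    using rat_vs.dependent_finite [OF assms(1)] assms(2) by blast
  obtain D c where D: "D > 0" and c: "\<And>u. u \<in> U \<Longrightarrow> of_int D * q u = of_int (c u)"
    using common_denominator [OF assms(1), of q] by metis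
  have "(\<Sum>u\<in>U. of_int (c u) * u) = (\<Sum>u\<in>U. of_int D * (of_rat (q u) * u))"
  proof (rule sum.cong [OF refl])
    fix u assume "u \<in> U"
    have "(of_int (c u) :: 'a) = of_rat (of_int D * q u)" using c [OF \<open>u \<in> U\<close>] by simp
    then show "of_int (c u) * u = of_int D * (of_rat (q u) * u)" by (simp add: of_rat_mult)
  qed
  also have "\<dots> = of_int D * (\<Sum>u\<in>U. of_rat (q u) * u)" by (simp add: sum_distrib_left)
  finally have "(\<Sum>u\<in>U. of_int (c u) * u) = 0" using q(3) by simp
  moreover have "c v \<noteq> 0" using c [OF q(1)] q(2) D by auto
  ultimately show thesis using that q(1) by blast
qed

text \<open>The exponent |c| suffices, as p^|c| exceeds |c|.\<close>

lemma eq_0_if_prime_powers_dvd: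
  fixes c p :: int
  assumes "p > 1" "\<And>n. p ^ n dvd c"
  shows "c = 0"
proof (rule ccontr)
  assume "c \<noteq> 0"
  then have "\<bar>p ^ nat \<bar>c\<bar>\<bar> \<le> \<bar>c\<bar>" using assms(2) by (rule dvd_imp_le_int)
  moreover obtain q where q: "p = int q" using assms(1) by (cases p) auto
  have "nat \<bar>c\<bar> < q ^ nat \<bar>c\<bar>" using assms(1) q by (intro power_gt_expt) auto
  then have "int (nat \<bar>c\<bar>) < p ^ nat \<bar>c\<bar>" unfolding q by (metis of_nat_less_iff of_nat_power)
  ultimately show False by simp
qed

section \<open>Quotients of a subring of finite rank\<close>

locale finite_rank_subring = field_subring R for R :: "'a :: field_char_0 set" +
  fixes B :: "'a set"
  assumes finB: "finite B" and span: "R \<subseteq> rat_vs.span B"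
begin

text \<open>R/pR is a vector space over the field with p elements, whose independent sets have at
  most \<open>card B\<close> elements. A largest one spans, so its combinations with coefficients
  from 0 to p-1 represent all classes.\<close>

lemma finite_index_prime:
  assumes p: "prime (p :: nat)"
  shows "finite_index ((*) (of_nat p) ` R)"
proof -
  define A where "A = (*) (of_nat p) ` R"
  have A: "ideal A RR" unfolding A_def by (rule ideal_principal) simp
  have pA: "of_int c * x \<in> A" if "int p dvd c" "x \<in> R" for c x
  proof -
    obtain k where "c = int p * k" using \<open>int p dvd c\<close> by blast
    then have "of_int c * x = of_nat p * (of_int k * x)" by (simp add: mult.assoc)
    then show ?thesis using that(2) unfolding A_def by (metis image_eqI mult_mem of_int_mem)
  qed
  have p1: "int p > 1" using prime_gt_1_nat [OF p] by simp
  have p0: "(of_nat p :: 'a) \<noteq> 0" using p1 by auto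
  \<comment> \<open>Independence modulo p of the classes in R/pR, expressed by integer
    coefficients.\<close>
  define indep where "indep U \<longleftrightarrow> finite U \<and> U \<subseteq> R \<and>
      (\<forall>c :: 'a \<Rightarrow> int. (\<Sum>u\<in>U. of_int (c u) * u) \<in> A \<longrightarrow> (\<forall>u\<in>U. int p dvd c u))" for U
  have card: "card U \<le> card B" if U: "indep U" for U
  proof -
    have finU: "finite U" and UR: "U \<subseteq> R" using U by (simp_all add: indep_def)
    \<comment> \<open>Dividing a relation by \<open>p\<close> gives a relation again.\<close>
    have dvd: "\<forall>u\<in>U. int p ^ n dvd c u" if "(\<Sum>u\<in>U. of_int (c u) * u) = 0" for c :: "'a \<Rightarrow> int" and n
      using that
    proof (induction n arbitrary: c)
      case (Suc n)
      have "(\<Sum>u\<in>U. of_int (c u) * u) \<in> A" using Suc.prems idealD(2) [OF A] by simp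
      then have d: "int p dvd c u" if "u \<in> U" for u using U that by (simp add: indep_def)
      have "(\<Sum>u\<in>U. of_int (c u) * u) = of_nat p * (\<Sum>u\<in>U. of_int (c u div int p) * u)"
        unfolding sum_distrib_left
      proof (rule sum.cong [OF refl])
        fix u assume "u \<in> U"
        have "(of_int (c u) :: 'a) = of_int (int p * (c u div int p))" using d [OF \<open>u \<in> U\<close>] by simp
        then show "of_int (c u) * u = of_nat p * (of_int (c u div int p) * u)" by (simp add: mult.assoc)
      qed
      then have "(\<Sum>u\<in>U. of_int (c u div int p) * u) = 0" using Suc.prems p0 by simp
      from Suc.IH [OF this] show ?case
      proof (intro ballI)
        fix u assume u: "u \<in> U" and "\<forall>u\<in>U. int p ^ n dvd c u div int p"
        then have "int p * int p ^ n dvd int p * (c u div int p)" by (intro mult_dvd_mono) auto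
        then show "int p ^ Suc n dvd c u" using d [OF u] by simp
      qed
    qed simp
    have "\<not> rat_vs.dependent U"
    proof
      assume "rat_vs.dependent U"
      \<comment> \<open>The coefficients of an integer relation are divisible by all powers of p,
        hence zero.\<close>
      then obtain c v where "v \<in> U" "c v \<noteq> 0" "(\<Sum>u\<in>U. of_int (c u) * u) = 0"
        using rat_dependent_imp_int [OF finU] by metis
      then show False using eq_0_if_prime_powers_dvd [OF p1, of "c v"] dvd by blast
    qed
    then show ?thesis
      using rat_vs.independent_span_bound [OF finB] UR span by blast
  qed
  have "indep {}" by (simp add: indep_def)
  moreover have "\<forall>U. indep U \<longrightarrow> card U < Suc (card B)" using card by (simp add: less_Suc_eq_le)
  ultimately obtain U where U: "indep U" and max: "\<And>V. indep V \<Longrightarrow> card V \<le> card U"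
    using ex_has_greatest_nat [of indep "{}" card "Suc (card B)"] by blast
  have finU: "finite U" and UR: "U \<subseteq> R" using U by (simp_all add: indep_def)
  define F where "F = (\<lambda>c :: 'a \<Rightarrow> int. \<Sum>u\<in>U. of_int (c u) * u) ` (U \<rightarrow>\<^sub>E {0..<int p})"
  \<comment> \<open>Every x depends on U modulo p with a coefficient prime to p. For x in U this is
    x - x = 0; otherwise maximality gives a relation, and if p divided the coefficient of x, U
    itself would be dependent.\<close>
  have relation: "\<exists>d c. \<not> int p dvd d \<and> of_int d * x + (\<Sum>u\<in>U. of_int (c u) * u) \<in> A"
    if x: "x \<in> R" for x
  proof (cases "x \<in> U")
    case True
    have "(\<Sum>u\<in>U. of_int (if u = x then - 1 else 0) * u) = - x"
      using finU True by (subst sum.remove [of _ x]) auto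
    then have "of_int 1 * x + (\<Sum>u\<in>U. of_int (if u = x then - 1 else 0) * u) \<in> A"
      using idealD(2) [OF A] by simp
    moreover have "\<not> int p dvd 1" using p1 by auto
    ultimately show ?thesis by (intro exI conjI)
  next
    case False
    have "\<not> indep (insert x U)"
    proof
      assume "indep (insert x U)"
      from max [OF this] show False using finU False by simp
    qed
    moreover have "finite (insert x U)" "insert x U \<subseteq> R" using finU UR x by simp_all
    ultimately obtain c v where c: "(\<Sum>u\<in>insert x U. of_int (c u) * u) \<in> A"
      and v: "v \<in> insert x U" "\<not> int p dvd c v"
      unfolding indep_def by metis
    have c': "of_int (c x) * x + (\<Sum>u\<in>U. of_int (c u) * u) \<in> A" using c finU False by simp
    moreover have "\<not> int p dvd c x"
    proof
      assume d: "int p dvd c x"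
      have "(\<Sum>u\<in>U. of_int (c u) * u) \<in> A"
        using idealD(7) [OF A c' pA [OF d x]] by simp
      then show False using U v d by (auto simp: indep_def)
    qed
    ultimately show ?thesis by (intro exI conjI)
  qed
  have "\<exists>f\<in>F. x - f \<in> A" if x: "x \<in> R" for x
  proof -
    obtain d c where d: "\<not> int p dvd d" and c: "of_int d * x + (\<Sum>u\<in>U. of_int (c u) * u) \<in> A"
      using relation [OF x] by blast
    \<comment> \<open>Here e inverts d modulo p, so modulo pR x equals e d x, the combination of U
      with coefficients -e c; \<open>c'\<close> reduces these to the range below p.\<close>
    have "coprime (int p) d" using p d by (intro prime_imp_coprime) auto
    then obtain m e where em: "m * int p + e * d = 1" using bezout_int [of "int p" d] by auto
    define c' where "c' = (\<lambda>u\<in>U. (- e * c u) mod int p)"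
    define f where "f = (\<Sum>u\<in>U. of_int (c' u) * u)"
    have "c' \<in> U \<rightarrow>\<^sub>E {0..<int p}" unfolding c'_def using p1 by auto
    then have "f \<in> F" unfolding F_def f_def by blast
    moreover have "x - f \<in> A"
    proof -
      have "int p dvd e * c u + c' u" if "u \<in> U" for u
      proof -
        have "int p dvd (- e * c u) mod int p - (- e * c u)"
          unfolding mod_eq_dvd_iff [symmetric] by simp
        moreover have "(- e * c u) mod int p - (- e * c u) = e * c u + c' u"
          using that by (simp add: c'_def)
        ultimately show ?thesis by (simp only:)
      qed
      then have 1: "(\<Sum>u\<in>U. of_int (e * c u + c' u) * u) \<in> A"
        using UR by (intro ideal_sum [OF A] pA) auto
      have 2: "of_int e * (of_int d * x + (\<Sum>u\<in>U. of_int (c u) * u)) \<in> A"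
        using idealD(4) [OF A _ c] by simp
      have 3: "of_int (m * int p) * x \<in> A" using x by (intro pA) auto
      have "x = of_int (m * int p + e * d) * x" by (simp only: em of_int_1 mult_1)
      then have "x - f = of_int (m * int p) * x + of_int e * (of_int d * x + (\<Sum>u\<in>U. of_int (c u) * u))
          - (\<Sum>u\<in>U. of_int (e * c u + c' u) * u)"
        by (simp add: f_def algebra_simps sum.distrib sum_distrib_left)
      also have "\<dots> \<in> A" by (intro idealD(7) [OF A] idealD(3) [OF A] 1 2 3)
      finally show ?thesis .
    qed
    ultimately show ?thesis by blast
  qed
  moreover have "finite F" unfolding F_def using finU by (intro finite_imageI finite_PiE) auto
  moreover have "F \<subseteq> R"
    unfolding F_def using UR by (auto intro!: ideal_sum [OF RR.oneideal, simplified])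
  ultimately show ?thesis unfolding finite_index_def A_def by blast
qed

lemma finite_index_of_nat:
  assumes "n > 0"
  shows "finite_index ((*) (of_nat n) ` R)"
  using assms
proof (induction n rule: less_induct)
  case (less n)
  show ?case
  proof (cases "n = 1")
    case True
    then show ?thesis unfolding finite_index_def by (intro exI [of _ "{0}"]) auto
  next
    case False
    then obtain p where p: "prime p" "p dvd n" using prime_factor_nat by blast
    then obtain m where m: "n = p * m" by blast
    then have "m > 0" "m < n" using less.prems prime_gt_1_nat [OF p(1)] by auto
    then show ?thesis
      using finite_index_mult [OF _ finite_index_prime [OF p(1)] _ less.IH [of m]] m by simp
  qed
qed

lemma int_poly_mem: "a \<in> R \<Longrightarrow> poly (map_poly of_int q) a \<in> R"
  by (induction q) (auto simp: map_poly_pCons)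

text \<open>The constant coefficient of a polynomial vanishing at a is a multiple of a; if it is
  zero, cancelling a leads to a polynomial of lower degree.\<close>

lemma int_multiple:
  assumes a: "a \<in> R" "a \<noteq> 0" and q: "q \<noteq> 0" "poly (map_poly of_int q) a = 0"
  shows "\<exists>m::int. m \<noteq> 0 \<and> of_int m \<in> (*) a ` R"
  using q
proof (induction q)
  case (pCons c q)
  have eq: "of_int c + a * poly (map_poly of_int q) a = 0"
    using pCons.prems by (simp add: map_poly_pCons)
  show ?case
  proof (cases "c = 0")
    case True
    then show ?thesis using eq a(2) pCons by auto
  next
    case False
    have "of_int c = a * (- poly (map_poly of_int q) a)"
      using eq by (simp add: eq_neg_iff_add_eq_0)
    then have "of_int c \<in> (*) a ` R" using int_poly_mem [OF a(1)] minus_mem by blast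
    with False show ?thesis by blast
  qed
qed simp

lemma finite_index_algebraic_int:
  assumes a: "a \<in> R" "a \<noteq> 0" "algebraic_int a"
  shows "finite_index ((*) a ` R)"
proof -
  obtain q where "poly (map_poly of_int q) a = 0" "lead_coeff q = (1::int)"
    using a(3) by (auto simp: algebraic_int_altdef_ipoly)
  then obtain m :: int where m: "m \<noteq> 0" "of_int m \<in> (*) a ` R"
    using int_multiple [OF a(1,2), of q] by force
  note A = ideal_principal [OF a(1)]
  have "(of_nat (nat \<bar>m\<bar>) :: 'a) = of_int m \<or> (of_nat (nat \<bar>m\<bar>) :: 'a) = - of_int m"
    by (cases "m \<ge> 0") auto
  then have "of_nat (nat \<bar>m\<bar>) \<in> (*) a ` R" using m(2) idealD(6) [OF A] by metis
  then have "(*) (of_nat (nat \<bar>m\<bar>)) ` R \<subseteq> (*) a ` R" using idealD(5) [OF A] by blast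
  with finite_index_of_nat [of "nat \<bar>m\<bar>"] m(1) show ?thesis using finite_index_mono by simp
qed

end

section \<open>Number fields\<close>

text \<open>\<open>dimension\<close> grows by one line extension at a time, and each contributes one
  vector to the spanning set.\<close>

lemma finite_dimension_rats_span:
  fixes E :: "'a :: field_char_0 set"
  assumes "ring.finite_dimension ring_of_type_algebra \<rat> E"
  shows "\<exists>B. finite B \<and> E \<subseteq> rat_vs.span B"
proof -
  interpret T: field "ring_of_type_algebra :: 'a ring" by (rule field_from_type_algebra)
  obtain n where "T.dimension n \<rat> E" using assms unfolding T.finite_dimension_def by blast
  then show ?thesis
  proof (induction n "\<rat> :: 'a set" E rule: T.dimension.induct)
    case zero_dim
    show ?case by (intro exI [of _ "{}"]) auto
  next
    case (Suc_dim v E n)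
    then obtain B where B: "finite B" "E \<subseteq> rat_vs.span B" by blast
    have "k * v + e \<in> rat_vs.span (insert v B)" if "k \<in> \<rat>" "e \<in> E" for k e
    proof -
      obtain q where "k = of_rat q" using \<open>k \<in> \<rat>\<close> by (auto elim: Rats_cases)
      then have "k * v \<in> rat_vs.span (insert v B)"
        using rat_vs.span_scale [OF rat_vs.span_base, of v "insert v B" q] by simp
      moreover have "e \<in> rat_vs.span (insert v B)"
        using B(2) that(2) rat_vs.span_mono [of B "insert v B"] by blast
      ultimately show ?thesis by (rule rat_vs.span_add)
    qed
    then have "T.line_extension \<rat> v E \<subseteq> rat_vs.span (insert v B)"
      by (auto simp: T.line_extension_mem_iff)
    with B(1) show ?case by (intro exI [of _ "insert v B"]) simp
  qed
qed

text \<open>The monic integer polynomial X^j - X^i takes an algebraic integer as its value at x.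
  This verifies \<open>integrally_closed\<close>.\<close>

lemma algebraic_int_power_diff:
  fixes x :: "'a :: field_char_0"
  assumes ij: "i < j" and x: "algebraic_int (x ^ j - x ^ i)"
  shows "algebraic_int x"
proof (rule algebraic_int_root [OF x])
  define p :: "'a poly" where "p = Polynomial.monom 1 j + Polynomial.monom (- 1) i"
  have deg: "degree p = j"
    unfolding p_def using ij by (subst degree_add_eq_left) (auto simp: degree_monom_eq)
  show "poly p x = x ^ j - x ^ i" by (simp add: p_def poly_monom)
  show "\<forall>i. coeff p i \<in> \<int>" by (auto simp: p_def)
  show "lead_coeff p = 1" unfolding deg using ij by (simp add: p_def)
  show "degree p > 0" using deg ij by simp
qed

theorem theorem1p1:
  fixes K :: "'a :: field_char_0 set" and \<nn> :: "'a set" and k :: nat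
  assumes "number_field K"
    and "ideal \<nn> (ring_of_integers K)"
    and "\<nn> \<noteq> {0}"
    and "k > 0"
  shows "real (gen_ideal_totient (ring_of_integers K) k \<nn>) =
           real (ideal_totient (ring_of_integers K) \<nn>) ^ k *
           (\<Prod>\<pp>\<in>prime_ideal_divisors (ring_of_integers K) \<nn>.
              \<Sum>j=0..k-1. (-1) ^ j / (real (ideal_norm (ring_of_integers K) \<pp>) - 1) ^ j)"
proof -
  interpret T: field "ring_of_type_algebra :: 'a ring" by (rule field_from_type_algebra)
  define R where "R = {x \<in> K. algebraic_int x}"
  have O: "ring_of_integers K = ring_of_type_algebra\<lparr>carrier := R\<rparr>"
    by (simp add: ring_of_integers_def R_def)
  \<comment> \<open>That the integers of K form a ring is contained in the hypothesis on \<nn>,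
    since \<open>ideal\<close> includes the ring axioms.\<close>
  interpret ring "ring_of_type_algebra\<lparr>carrier := R\<rparr>"
    using assms(2) ideal.axioms(2) unfolding O by blast
  interpret field_subring R
  proof
    show "- x \<in> R" if "x \<in> R" for x
    proof -
      have "x + \<ominus>\<^bsub>ring_of_type_algebra\<lparr>carrier := R\<rparr>\<^esub> x = 0" using r_neg [of x] that by simp
      then have "\<ominus>\<^bsub>ring_of_type_algebra\<lparr>carrier := R\<rparr>\<^esub> x = - x" by (simp add: add_eq_0_iff)
      then show ?thesis using a_inv_closed [of x] that by simp
    qed
  qed (use zero_closed one_closed a_closed m_closed in auto)
  have sub: "subfield K (ring_of_type_algebra :: 'a ring)"
    and dim: "ring.finite_dimension ring_of_type_algebra \<rat> K"
    using assms(1) by (simp_all add: number_field_def)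
  obtain B where B: "finite B" "K \<subseteq> rat_vs.span B" using finite_dimension_rats_span [OF dim] by blast
  interpret finite_rank_subring R B using B by unfold_locales (auto simp: R_def)
  \<comment> \<open>The inverse in the sense of \<open>ring_of_type_algebra\<close> is identified
    with the \<open>inverse\<close> of the type.\<close>
  have div: "b / a \<in> K" if "a \<in> K" "b \<in> K" "a \<noteq> 0" for a b
  proof -
    have "inv\<^bsub>ring_of_type_algebra\<^esub> a \<in> K" "a * inv\<^bsub>ring_of_type_algebra\<^esub> a = 1"
      using T.subfield_m_inv [OF sub, of a] that by auto
    moreover from this have "inv\<^bsub>ring_of_type_algebra\<^esub> a = inverse a"
      using inverse_unique by metis
    ultimately show ?thesis
      using subringE(6) [OF subfieldE(1) [OF sub], of b "inverse a"] that by (simp add: field_simps)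
  qed
  interpret residually_finite_subring R
  proof
    show "finite_index ((*) a ` R)" if "a \<in> R" "a \<noteq> 0" for a
      using finite_index_algebraic_int that by (simp add: R_def)
    fix a b :: 'a and i j :: nat
    assume *: "a \<in> R" "b \<in> R" "a \<noteq> 0" "i < j" "(b / a) ^ j - (b / a) ^ i \<in> R"
    have "algebraic_int (b / a)"
      by (rule algebraic_int_power_diff [OF *(4)]) (use *(5) in \<open>simp add: R_def\<close>)
    then show "b / a \<in> R" using div * by (simp add: R_def)
  qed
  show ?thesis using gen_ideal_totient_eq assms(2-4) unfolding O by blast
qed

end
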